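(* Let $n\ge 3$. Let $X^n$ and $Y^n$ be the $3$-uniform hypergraphs on the vertex set $\{0,1,\dots,2^n\}$ defined in the context. Then the principal eigenvalue of $X^n$ and the principal eigenvalue of $Y^n$ are different.
   Context: **Hypergraphs and Lagrangians.** A hypergraph is a pair $(V,E)$ with $E\subseteq 2^V$; it is uniform of rank $m$ if all edges have size $m$. A uniform hypergraph $\mathcal H$ is identified with its Lagrangian polynomial $\mathcal H(\mathbf x)=\sum_{e\in E(\mathcal H)}\prod_{i\in e}x_i$. For a vertex $i$, the link is $\mathcal H[i]=\partial \mathcal H/\partial x_i$. **Principal eigenpair.** For $\mathcal H$ uniform of rank $m$, a pair $(\lambda,\mathbf x)$ with $\mathbf x\neq 0$ is an eigenpair if $\mathcal H[i](\mathbf x)=\lambda x_i^{m-1}$ for every vertex $i$. If $\mathcal H$ is connected, there is a unique eigenvalue $\lambda$ having an eigenvector $\mathbf v$ with all coordinates strictly positive and $\sum_i v_i^m=1$, and this $\mathbf v$ is unique; $\lambda$ is the principal eigenvalue (spectral radius), $\mathbf v$ the principal eigenvector. The hypergraphs $X^n,Y^n$ below are connected. **Construction.** Let $V_n=\{1,\dots,2^n\}$. In polynomials of level $n$ (superscript $n$), indices of variables are reduced modulo $2^n$ to the representative in $V_n$; $x_0$ is an additional separate variable (never obtained by such a reduction). For $2\le r\le n$ let $\mathrm E^n_r$ be the $\mathbb C$-algebra homomorphism with $\mathrm E^n_r(x_i)=\sum_{j\in V_n,\ j\equiv i\ (\mathrm{mod}\ 2^r)}x_j$ (so $\mathrm E_n^n$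 is the identity). For $n\ge 4$ let $p^n_0,p^n_1:\mathbb C[x_1,\dots,x_{2^{n-1}}]\to\mathbb C[x_1,\dots,x_{2^n}]$ be the $\mathbb C$-algebra homomorphisms with $p^n_0(x_i)=x_{2i}$, $p^n_1(x_i)=x_{2i-1}$. Define - $G_3^3=\sum_{i=1}^8 x_{i-1}x_ix_{i+1}+\sum_{i=1}^8x_{i-3}x_ix_{i+3}$ (indices modulo $8$ in $V_3$), and $G_n^n=\mathrm E_3^n(G_3^3)$ for $n\ge4$; - $G_2^3=\sum_{i=1}^4x_ix_{i+2}x_{i+4}$, and $G_k^n=p_0^n(G_k^{n-1})+p_1^n(G_k^{n-1})$ for $n\ge 4$, $2\le k<n$; - $\Gamma_n=\sum_{k=2}^nG_k^n$; - $M_0^n=x_0\,\mathrm E_2^n(x_1x_2+x_3x_4)$, $M_1^n=x_0\,\mathrm E_2^n(x_1x_4+x_2x_3)$; - $X^n=\Gamma_n+M_0^n$, $Y^n=\Gamma_n+M_1^n$. Each of these polynomials is the Lagrangian of a $3$-uniform hypergraph; $X^n,Y^n$ have vertex set $\{0,1,\dots,2^n\}$. *)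

theory Defs
  imports Complex_Main "HOL-Library.Poly_Mapping"
begin

section \<open>Multivariate polynomials\<close>

text \<open>A polynomial in the variables \<open>x\<^sub>0, x\<^sub>1, x\<^sub>2, \<dots>\<close> is a finitely supported map from monomials
  (exponent vectors) to coefficients; ring operations and equality are those of the library.\<close>

type_synonym 'a mpoly = "(nat \<Rightarrow>\<^sub>0 nat) \<Rightarrow>\<^sub>0 'a"

definition Const :: "'a::zero \<Rightarrow> 'a mpoly" where
  "Const c = Poly_Mapping.single 0 c"

definition Var :: "nat \<Rightarrow> 'a::zero_neq_one mpoly" where
  "Var i = Poly_Mapping.single (Poly_Mapping.single i 1) 1"

text \<open>For a ring homomorphism \<open>\<phi>\<close>, this is the unique ring homomorphism extending \<open>\<phi>\<close> that sends
  \<open>x\<^sub>i\<close> to \<open>\<sigma> i\<close> (see the lemmas below).\<close>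

definition mpoly_hom ::
  "('a::comm_semiring_1 \<Rightarrow> 'b::comm_semiring_1) \<Rightarrow> (nat \<Rightarrow> 'b) \<Rightarrow> 'a mpoly \<Rightarrow> 'b" where
  "mpoly_hom \<phi> \<sigma> p =
     (\<Sum>m\<in>Poly_Mapping.keys p. \<phi> (Poly_Mapping.lookup p m) *
        (\<Prod>i\<in>Poly_Mapping.keys m. \<sigma> i ^ Poly_Mapping.lookup m i))"

definition subst :: "(nat \<Rightarrow> 'a::comm_semiring_1 mpoly) \<Rightarrow> 'a mpoly \<Rightarrow> 'a mpoly" where
  "subst = mpoly_hom Const"

definition eval_at :: "(nat \<Rightarrow> 'a::comm_semiring_1) \<Rightarrow> 'a mpoly \<Rightarrow> 'a" where
  "eval_at = mpoly_hom (\<lambda>c. c)"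

definition partial_deriv :: "nat \<Rightarrow> 'a::comm_semiring_1 mpoly \<Rightarrow> 'a mpoly" where
  "partial_deriv i p =
     (\<Sum>m\<in>Poly_Mapping.keys p. Poly_Mapping.single (m - Poly_Mapping.single i 1)
        (of_nat (Poly_Mapping.lookup m i) * Poly_Mapping.lookup p m))"

lemma mpoly_hom_add:
  assumes "\<phi> 0 = 0" and "\<And>a b. \<phi> (a + b) = \<phi> a + \<phi> b"
  shows "mpoly_hom \<phi> \<sigma> (p + q) = mpoly_hom \<phi> \<sigma> p + mpoly_hom \<phi> \<sigma> q"
  unfolding mpoly_hom_def
  by (rule setsum_keys_plus_distrib) (simp_all add: assms distrib_right)

lemma mpoly_hom_single:
  assumes "\<phi> 0 = 0"
  shows "mpoly_hom \<phi> \<sigma> (Poly_Mapping.single m c) =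
    \<phi> c * (\<Prod>i\<in>Poly_Mapping.keys m. \<sigma> i ^ Poly_Mapping.lookup m i)"
  by (cases "c = 0") (simp_all add: mpoly_hom_def assms)

lemma mpoly_hom_Const:
  assumes "\<phi> 0 = 0"
  shows "mpoly_hom \<phi> \<sigma> (Const c) = \<phi> c"
  by (simp add: Const_def mpoly_hom_single assms)

lemma mpoly_hom_Var:
  assumes "\<phi> 0 = 0" and "\<phi> 1 = 1"
  shows "mpoly_hom \<phi> \<sigma> (Var i) = \<sigma> i"
  by (simp add: Var_def mpoly_hom_single assms)

lemma monomial_eval_add:
  fixes \<sigma> :: "nat \<Rightarrow> 'b::comm_semiring_1" and m k :: "nat \<Rightarrow>\<^sub>0 nat"
  shows "(\<Prod>i\<in>Poly_Mapping.keys (m + k). \<sigma> i ^ Poly_Mapping.lookup (m + k) i) =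
    (\<Prod>i\<in>Poly_Mapping.keys m. \<sigma> i ^ Poly_Mapping.lookup m i) *
    (\<Prod>i\<in>Poly_Mapping.keys k. \<sigma> i ^ Poly_Mapping.lookup k i)"
proof -
  let ?K = "Poly_Mapping.keys m \<union> Poly_Mapping.keys k"
  have *: "(\<Prod>i\<in>Poly_Mapping.keys l. \<sigma> i ^ Poly_Mapping.lookup l i) =
      (\<Prod>i\<in>?K. \<sigma> i ^ Poly_Mapping.lookup l i)"
    if "Poly_Mapping.keys l \<subseteq> ?K" for l :: "nat \<Rightarrow>\<^sub>0 nat"
    by (rule prod.mono_neutral_left) (use that in \<open>auto simp: in_keys_iff\<close>)
  show ?thesis
    using *[of m] *[of k] *[of "m + k"] keys_add[of m k]
    by (simp add: lookup_add power_add prod.distrib)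
qed

lemma mpoly_hom_sum:
  assumes "\<phi> 0 = 0" and "\<And>a b. \<phi> (a + b) = \<phi> a + \<phi> b"
  shows "mpoly_hom \<phi> \<sigma> (sum f A) = (\<Sum>a\<in>A. mpoly_hom \<phi> \<sigma> (f a))"
proof (induction A rule: infinite_finite_induct)
  case (insert a A)
  then show ?case by (simp add: mpoly_hom_add[of \<phi>, OF assms])
qed (simp_all add: mpoly_hom_def)

lemma mpoly_eq_sum_single:
  fixes p :: "'a::comm_monoid_add mpoly"
  shows "p = (\<Sum>m\<in>Poly_Mapping.keys p. Poly_Mapping.single m (Poly_Mapping.lookup p m))"
  by (rule poly_mapping_eqI)
    (auto simp: lookup_sum lookup_single when_def sum.delta in_keys_iff)

lemma mpoly_hom_mult:
  assumes 0: "\<phi> 0 = 0" and add: "\<And>a b. \<phi> (a + b) = \<phi> a + \<phi> b"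
    and mult: "\<And>a b. \<phi> (a * b) = \<phi> a * \<phi> b"
  shows "mpoly_hom \<phi> \<sigma> (p * q) = mpoly_hom \<phi> \<sigma> p * mpoly_hom \<phi> \<sigma> q"
proof -
  let ?s = "\<lambda>p m. Poly_Mapping.single m (Poly_Mapping.lookup p m)"
  have "p * q = (\<Sum>m\<in>Poly_Mapping.keys p. \<Sum>k\<in>Poly_Mapping.keys q. ?s p m * ?s q k)"
    by (subst mpoly_eq_sum_single[of p], subst mpoly_eq_sum_single[of q])
      (simp only: sum_product)
  then have "mpoly_hom \<phi> \<sigma> (p * q) =
      (\<Sum>m\<in>Poly_Mapping.keys p. \<Sum>k\<in>Poly_Mapping.keys q.
         mpoly_hom \<phi> \<sigma> (?s p m) * mpoly_hom \<phi> \<sigma> (?s q k))"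
    by (simp add: mpoly_hom_sum[of \<phi>, OF 0 add] mult_single mpoly_hom_single[of \<phi>, OF 0]
        mult monomial_eval_add ac_simps)
  also have "\<dots> = mpoly_hom \<phi> \<sigma> p * mpoly_hom \<phi> \<sigma> q"
    by (simp add: sum_product mpoly_hom_single[of \<phi>, OF 0])
      (simp add: mpoly_hom_def sum_product)
  finally show ?thesis .
qed


section \<open>Hypergraphs, Lagrangians and principal eigenvalues\<close>

type_synonym hypergraph = "nat set \<times> nat set set"

definition uniform :: "nat \<Rightarrow> hypergraph \<Rightarrow> bool" where
  "uniform m H \<longleftrightarrow> (\<forall>e\<in>snd H. e \<subseteq> fst H \<and> finite e \<and> card e = m)"

definition lagrangian :: "hypergraph \<Rightarrow> complex mpoly" where
  "lagrangian H = (\<Sum>e\<in>snd H. \<Prod>i\<in>e. Var i)"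

definition link :: "hypergraph \<Rightarrow> nat \<Rightarrow> complex mpoly" where
  "link H i = partial_deriv i (lagrangian H)"

text \<open>Vectors are functions on \<open>nat\<close> of which only the values on the vertex set matter.\<close>

definition eigenpair :: "nat \<Rightarrow> hypergraph \<Rightarrow> complex \<Rightarrow> (nat \<Rightarrow> complex) \<Rightarrow> bool" where
  "eigenpair m H l x \<longleftrightarrow>
     uniform m H \<and> (\<exists>i\<in>fst H. x i \<noteq> 0) \<and>
     (\<forall>i\<in>fst H. eval_at x (link H i) = l * x i ^ (m - 1))"

definition principal_eigenpair :: "nat \<Rightarrow> hypergraph \<Rightarrow> complex \<Rightarrow> (nat \<Rightarrow> real) \<Rightarrow> bool" where
  "principal_eigenpair m H l v \<longleftrightarrow>
     eigenpair m H l (\<lambda>i. complex_of_real (v i)) \<and>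
     (\<forall>i\<in>fst H. v i > 0) \<and> (\<Sum>i\<in>fst H. v i ^ m) = 1"

definition principal_eigenvalue :: "nat \<Rightarrow> hypergraph \<Rightarrow> complex" where
  "principal_eigenvalue m H = (THE l. \<exists>v. principal_eigenpair m H l v)"

text \<open>The identification of a polynomial with the hypergraph on \<open>V\<close> whose Lagrangian it is;
  lemma \<open>hypergraph_of_lagrangian\<close> states that this inverts \<open>lagrangian\<close>.\<close>

definition hypergraph_of :: "nat set \<Rightarrow> complex mpoly \<Rightarrow> hypergraph" where
  "hypergraph_of V p = (V, THE E. E \<subseteq> Pow V \<and> lagrangian (V, E) = p)"

lemma prod_Var:
  "(\<Prod>i\<in>e. Var i :: 'a::comm_semiring_1 mpoly) =
     Poly_Mapping.single (\<Sum>i\<in>e. Poly_Mapping.single i 1) 1"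
  by (induction e rule: infinite_finite_induct) (simp_all add: Var_def mult_single)

lemma lookup_sum_single:
  assumes "finite e"
  shows "Poly_Mapping.lookup (\<Sum>i\<in>e. Poly_Mapping.single i (1::nat)) j = (if j \<in> e then 1 else 0)"
  using assms by (simp add: lookup_sum lookup_single when_def)

lemma lookup_lagrangian:
  assumes "finite V" and "E \<subseteq> Pow V" and "finite e"
  shows "Poly_Mapping.lookup (lagrangian (V, E)) (\<Sum>i\<in>e. Poly_Mapping.single i 1) =
    (if e \<in> E then 1 else 0)"
proof -
  have fin: "finite E" using assms by (meson finite_Pow_iff finite_subset)
  have inj: "(\<Sum>i\<in>f. Poly_Mapping.single i (1::nat)) = (\<Sum>i\<in>e. Poly_Mapping.single i 1) \<longleftrightarrow> f = e"
    if "f \<in> E" for f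
  proof
    have "finite f" using that assms by (meson PowD finite_subset subsetD)
    moreover assume "(\<Sum>i\<in>f. Poly_Mapping.single i (1::nat)) = (\<Sum>i\<in>e. Poly_Mapping.single i 1)"
    ultimately have "(if j \<in> f then 1 else 0) = (if j \<in> e then 1 else (0::nat))" for j
      by (metis lookup_sum_single assms(3))
    then show "f = e" by (metis set_eqI zero_neq_one)
  qed simp
  have "Poly_Mapping.lookup (lagrangian (V, E)) (\<Sum>i\<in>e. Poly_Mapping.single i 1) =
      (\<Sum>f\<in>E. if f = e then 1 else 0)"
    unfolding lagrangian_def snd_conv prod_Var lookup_sum
    by (rule sum.cong) (simp_all only: lookup_single when_def inj)
  then show ?thesis using fin by simp
qed

lemma hypergraph_of_lagrangian:
  assumes "finite V" and "E \<subseteq> Pow V"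
  shows "hypergraph_of V (lagrangian (V, E)) = (V, E)"
proof -
  have "F = E" if "F \<subseteq> Pow V" and eq: "lagrangian (V, F) = lagrangian (V, E)" for F
  proof -
    have "e \<in> F \<longleftrightarrow> e \<in> E" if "e \<subseteq> V" for e
      using lookup_lagrangian[OF assms(1) \<open>F \<subseteq> Pow V\<close>, of e] lookup_lagrangian[OF assms, of e]
        finite_subset[OF that assms(1)] eq by (metis zero_neq_one)
    then show ?thesis using \<open>F \<subseteq> Pow V\<close> assms(2) by blast
  qed
  then have "(THE F. F \<subseteq> Pow V \<and> lagrangian (V, F) = lagrangian (V, E)) = E"
    using assms(2) by (intro the_equality) auto
  then show ?thesis by (simp add: hypergraph_of_def)
qed


section \<open>The construction\<close>

text \<open>\<open>x\<^sub>k\<close> at level \<open>n\<close>, with \<open>k\<close> reduced modulo \<open>2^n\<close> to its representative in \<open>{1..2^n}\<close>.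
  The separate variable \<open>x\<^sub>0\<close> is \<open>Var 0\<close>.\<close>

definition Var_mod :: "nat \<Rightarrow> int \<Rightarrow> complex mpoly" where
  "Var_mod n k = Var (nat ((k - 1) mod 2 ^ n + 1))"

text \<open>\<open>Ehom r n\<close> is the map \<open>E\<close> with lower index \<open>r\<close> and upper index \<open>n\<close>.\<close>

definition Ehom :: "nat \<Rightarrow> nat \<Rightarrow> complex mpoly \<Rightarrow> complex mpoly" where
  "Ehom r n = subst (\<lambda>i. \<Sum>j | j \<in> {1..2 ^ n} \<and> j mod 2 ^ r = i mod 2 ^ r. Var j)"

definition p0 :: "complex mpoly \<Rightarrow> complex mpoly" where
  "p0 = subst (\<lambda>i. Var (2 * i))"

definition p1 :: "complex mpoly \<Rightarrow> complex mpoly" where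
  "p1 = subst (\<lambda>i. Var (2 * i - 1))"

definition G33 :: "complex mpoly" where
  "G33 = (\<Sum>i=1..8::int. Var_mod 3 (i - 1) * Var_mod 3 i * Var_mod 3 (i + 1)) +
         (\<Sum>i=1..8::int. Var_mod 3 (i - 3) * Var_mod 3 i * Var_mod 3 (i + 3))"

definition G23 :: "complex mpoly" where
  "G23 = (\<Sum>i=1..4::nat. Var i * Var (i + 2) * Var (i + 4))"

text \<open>\<open>G_poly n k\<close> has upper index (level) \<open>n\<close> and lower index \<open>k\<close>; it is meaningful for
  \<open>n \<ge> 3\<close> and \<open>2 \<le> k \<le> n\<close>, and \<open>0\<close> otherwise.\<close>

fun G_poly :: "nat \<Rightarrow> nat \<Rightarrow> complex mpoly" where
  "G_poly n k =
    (if n < 3 \<or> k < 2 \<or> n < k then 0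
     else if n = 3 then (if k = 3 then G33 else G23)
     else if k = n then Ehom 3 n G33
     else p0 (G_poly (n - 1) k) + p1 (G_poly (n - 1) k))"

declare G_poly.simps [simp del]

definition Gam :: "nat \<Rightarrow> complex mpoly" where
  "Gam n = (\<Sum>k=2..n. G_poly n k)"

definition M0 :: "nat \<Rightarrow> complex mpoly" where
  "M0 n = Var 0 * Ehom 2 n (Var 1 * Var 2 + Var 3 * Var 4)"

definition M1 :: "nat \<Rightarrow> complex mpoly" where
  "M1 n = Var 0 * Ehom 2 n (Var 1 * Var 4 + Var 2 * Var 3)"

definition X_hyp :: "nat \<Rightarrow> hypergraph" where
  "X_hyp n = hypergraph_of {0..2 ^ n} (Gam n + M0 n)"

definition Y_hyp :: "nat \<Rightarrow> hypergraph" where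
  "Y_hyp n = hypergraph_of {0..2 ^ n} (Gam n + M1 n)"

end

theory Submission
  imports Defs "HOL-Analysis.Analysis"
begin

text \<open>
  Write \<open>a\<^sub>1, \<dots>, a\<^sub>4\<close> for the sums of the coordinates over the residue classes modulo \<open>4\<close>, so that
  \<open>Y - X = x\<^sub>0 (a\<^sub>1 - a\<^sub>3) (a\<^sub>4 - a\<^sub>2)\<close>. The reflection \<open>j \<mapsto> 2^n + 1 - j\<close> is an automorphism of \<open>X\<close>, so
  its principal eigenvector \<open>v\<close> has \<open>a\<^sub>1 = a\<^sub>4\<close> and \<open>a\<^sub>2 = a\<^sub>3\<close>, whence \<open>Y v - X v = v\<^sub>0 (a\<^sub>1 - a\<^sub>2)\<^sup>2 \<ge> 0\<close>. As the
  principal eigenvalue is the maximum of three times the Lagrangian on the positive unit sphere of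
  the 3-norm, equality of the two eigenvalues forces all \<open>a\<^sub>i\<close> to be equal. Then \<open>v\<close> solves a system
  \<open>\<Gamma>\<^sub>n[j](v) + c = \<lambda> v\<^sub>j\<^sup>2\<close> with constant \<open>c > 0\<close> and equal class sums. Its restriction to the even
  indices solves a system of the same kind one level lower: the forcing term may a priori depend on
  the parity of the index, but a strict concavity argument excludes this and makes the restriction
  symmetric under reflection. Hence the problem descends to level \<open>3\<close>, where it is an explicit system
  in four unknowns without positive solutions.
\<close>

section \<open>Lagrangians of 3-uniform hypergraphs\<close>

text \<open>Generic in the semiring, so that one expression covers both the formal Lagrangian (at
  \<open>Var\<close>) and its values at real vectors.\<close>

definition edge_sum :: "nat set set \<Rightarrow> (nat \<Rightarrow> 'a::comm_semiring_1) \<Rightarrow> 'a" where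
  "edge_sum E x = (\<Sum>e\<in>E. \<Prod>i\<in>e. x i)"

definition link_sum :: "nat set set \<Rightarrow> nat \<Rightarrow> (nat \<Rightarrow> 'a::comm_semiring_1) \<Rightarrow> 'a" where
  "link_sum E i x = (\<Sum>e | e \<in> E \<and> i \<in> e. \<Prod>j\<in>e - {i}. x j)"

definition triple_system :: "nat set \<Rightarrow> nat set set \<Rightarrow> bool" where
  "triple_system V E \<longleftrightarrow> finite V \<and> (\<forall>e\<in>E. e \<subseteq> V \<and> card e = 3)"

lemma lagrangian_eq_edge_sum: "lagrangian (V, E) = edge_sum E Var"
  by (simp add: lagrangian_def edge_sum_def)

lemma triple_system_finite:
  assumes "triple_system V E"
  shows "finite V" "finite E" "\<And>e. e \<in> E \<Longrightarrow> finite e" "E \<subseteq> Pow V"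
proof -
  show "finite V" and *: "E \<subseteq> Pow V"
    using assms by (auto simp: triple_system_def)
  then show "finite E" "\<And>e. e \<in> E \<Longrightarrow> finite e"
    by (meson finite_Pow_iff finite_subset PowD subsetD)+
qed

lemma triple_system_mem: "triple_system V E \<Longrightarrow> e \<in> E \<Longrightarrow> i \<in> e \<Longrightarrow> i \<in> V"
  unfolding triple_system_def by blast

lemma edge_sum_Un:
  assumes "finite E" "finite F" "E \<inter> F = {}"
  shows "edge_sum (E \<union> F) x = edge_sum E x + edge_sum F x"
  using assms by (simp add: edge_sum_def sum.union_disjoint)

lemma edge_sum_cong:
  assumes "\<And>e i. e \<in> E \<Longrightarrow> i \<in> e \<Longrightarrow> x i = y i"
  shows "edge_sum E x = edge_sum E y"
  using assms by (auto simp: edge_sum_def intro!: sum.cong prod.cong)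

text \<open>An edge contains a vertex at most once, so the edge sum is affine in each single
  variable, with the link as slope.\<close>

lemma edge_sum_upd:
  fixes x :: "nat \<Rightarrow> 'a::comm_ring_1"
  assumes "finite E" "\<And>e. e \<in> E \<Longrightarrow> finite e"
  shows "edge_sum E (x(i := t)) = edge_sum E x + (t - x i) * link_sum E i x"
proof -
  have "(\<Prod>j\<in>e. (x(i := t)) j) =
      (\<Prod>j\<in>e. x j) + (t - x i) * (if i \<in> e then \<Prod>j\<in>e - {i}. x j else 0)"
    if "e \<in> E" for e
  proof (cases "i \<in> e")
    case True
    have "(\<Prod>j\<in>e - {i}. (x(i := t)) j) = (\<Prod>j\<in>e - {i}. x j)"
      by (rule prod.cong) auto
    then show ?thesis
      using True assms(2)[OF that] by (simp add: prod.remove[of e i] algebra_simps)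
  next
    case False
    then have "(\<Prod>j\<in>e. (x(i := t)) j) = (\<Prod>j\<in>e. x j)"
      by (intro prod.cong) auto
    then show ?thesis using False by simp
  qed
  then have "edge_sum E (x(i := t)) = edge_sum E x +
      (t - x i) * (\<Sum>e\<in>E. if i \<in> e then \<Prod>j\<in>e - {i}. x j else 0)"
    by (simp add: edge_sum_def sum.distrib sum_distrib_left)
  then show ?thesis
    using assms(1) by (simp add: link_sum_def sum.inter_filter)
qed

text \<open>A slope is a unit difference. This form computes links from closed formulas for edge
  sums, without listing the edges through a vertex.\<close>

lemma link_sum_eq_diff:
  fixes x :: "nat \<Rightarrow> 'a::comm_ring_1"
  assumes "triple_system V E"
  shows "link_sum E i x = edge_sum E (x(i := x i + 1)) - edge_sum E x"
  using edge_sum_upd[OF triple_system_finite(2,3)[OF assms], where x = x and i = i and t = "x i + 1"]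
  by simp

text \<open>Double counting of incidences: multiplying the link at \<open>i\<close> by
  \<open>x i\<close> restores the full monomials of the edges through \<open>i\<close>. Weights
  \<open>c = 1\<close> give Euler's identity; cubed ratios of two vectors give the comparison
  below.\<close>

lemma sum_mult_link_sum:
  assumes "triple_system V E"
  shows "(\<Sum>i\<in>V. c i * (x i * link_sum E i x)) = (\<Sum>e\<in>E. (\<Sum>i\<in>e. c i) * (\<Prod>i\<in>e. x i))"
proof -
  note fin = triple_system_finite[OF assms]
  have "x i * link_sum E i x = (\<Sum>e | e \<in> E \<and> i \<in> e. \<Prod>j\<in>e. x j)" for i
    unfolding link_sum_def sum_distrib_left
    by (rule sum.cong) (use fin in \<open>auto simp: prod.remove[of _ i]\<close>)
  then have "(\<Sum>i\<in>V. c i * (x i * link_sum E i x)) =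
      (\<Sum>i\<in>V. \<Sum>e | e \<in> E \<and> i \<in> e. c i * (\<Prod>j\<in>e. x j))"
    by (simp add: sum_distrib_left)
  also have "\<dots> = (\<Sum>e\<in>E. \<Sum>i | i \<in> V \<and> i \<in> e. c i * (\<Prod>j\<in>e. x j))"
    using fin by (intro sum.swap_restrict)
  also have "\<dots> = (\<Sum>e\<in>E. (\<Sum>i\<in>e. c i) * (\<Prod>i\<in>e. x i))"
  proof (rule sum.cong)
    fix e assume "e \<in> E"
    then have "{i. i \<in> V \<and> i \<in> e} = e" using fin(4) by auto
    then show "(\<Sum>i | i \<in> V \<and> i \<in> e. c i * (\<Prod>j\<in>e. x j)) = (\<Sum>i\<in>e. c i) * (\<Prod>i\<in>e. x i)"
      by (simp add: sum_distrib_right)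
  qed simp
  finally show ?thesis .
qed

lemma sum_link_sum_eq_edge_sum:
  assumes "triple_system V E"
  shows "(\<Sum>i\<in>V. x i * link_sum E i x) = 3 * edge_sum E x"
proof -
  have "(\<Sum>i\<in>V. x i * link_sum E i x) = (\<Sum>e\<in>E. (\<Sum>i\<in>e. 1) * (\<Prod>i\<in>e. x i))"
    using sum_mult_link_sum[OF assms, of "\<lambda>_. 1" x] by simp
  also have "\<dots> = (\<Sum>e\<in>E. 3 * (\<Prod>i\<in>e. x i))"
    by (rule sum.cong) (use assms in \<open>auto simp: triple_system_def\<close>)
  finally show ?thesis by (simp add: edge_sum_def sum_distrib_left)
qed

section \<open>The arithmetic-geometric mean inequality along edges\<close>

lemma three_mult_le_sum_cubes:
  fixes a b c :: real
  assumes "a > 0" "b > 0" "c > 0"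
  shows "3 * (a * b * c) \<le> a ^ 3 + b ^ 3 + c ^ 3"
    and "3 * (a * b * c) = a ^ 3 + b ^ 3 + c ^ 3 \<Longrightarrow> a = b \<and> b = c"
proof -
  have eq: "a ^ 3 + b ^ 3 + c ^ 3 - 3 * (a * b * c) =
      (a + b + c) / 2 * ((a - b)\<^sup>2 + (b - c)\<^sup>2 + (c - a)\<^sup>2)"
    by (simp add: field_simps power2_eq_square power3_eq_cube)
  have "(a + b + c) / 2 * ((a - b)\<^sup>2 + (b - c)\<^sup>2 + (c - a)\<^sup>2) \<ge> 0"
    using assms by simp
  with eq show "3 * (a * b * c) \<le> a ^ 3 + b ^ 3 + c ^ 3" by linarith
  assume "3 * (a * b * c) = a ^ 3 + b ^ 3 + c ^ 3"
  with eq assms have "(a - b)\<^sup>2 + (b - c)\<^sup>2 + (c - a)\<^sup>2 = 0" by simp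
  then have "(a - b)\<^sup>2 = 0" "(b - c)\<^sup>2 = 0"
    using zero_le_power2[of "a - b"] zero_le_power2[of "b - c"] zero_le_power2[of "c - a"]
    by linarith+
  then show "a = b \<and> b = c" by simp
qed

lemma three_prod_le_sum_cubes:
  fixes r :: "'b \<Rightarrow> real"
  assumes "card e = 3" "\<And>i. i \<in> e \<Longrightarrow> r i > 0"
  shows "3 * (\<Prod>i\<in>e. r i) \<le> (\<Sum>i\<in>e. r i ^ 3)"
    and "3 * (\<Prod>i\<in>e. r i) = (\<Sum>i\<in>e. r i ^ 3) \<Longrightarrow> i \<in> e \<Longrightarrow> j \<in> e \<Longrightarrow> r i = r j"
proof -
  obtain a b c where e: "e = {a, b, c}" "a \<noteq> b" "b \<noteq> c" "a \<noteq> c"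
    using assms(1) by (auto simp: card_3_iff)
  have pos: "r a > 0" "r b > 0" "r c > 0" using assms(2) e by auto
  show "3 * (\<Prod>i\<in>e. r i) \<le> (\<Sum>i\<in>e. r i ^ 3)"
    using three_mult_le_sum_cubes(1)[OF pos] e by (simp add: algebra_simps)
  assume "3 * (\<Prod>i\<in>e. r i) = (\<Sum>i\<in>e. r i ^ 3)" "i \<in> e" "j \<in> e"
  then show "r i = r j"
    using three_mult_le_sum_cubes(2)[OF pos] e by (auto simp: algebra_simps)
qed

text \<open>On each edge, apply the inequality of means to the ratios \<open>w i / u i\<close> and
  multiply by the product of the \<open>u i\<close>; summing over the edges is weighted double
  counting. Equality of the sums forces equality on every edge, hence constant ratios there.\<close>

lemma edge_sum_le_link_sum:
  fixes u w :: "nat \<Rightarrow> real"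
  assumes E: "triple_system V E" and u: "\<And>i. i \<in> V \<Longrightarrow> u i > 0" and w: "\<And>i. i \<in> V \<Longrightarrow> w i > 0"
  shows "3 * edge_sum E w \<le> (\<Sum>i\<in>V. (w i / u i) ^ 3 * (u i * link_sum E i u))"
    and "3 * edge_sum E w = (\<Sum>i\<in>V. (w i / u i) ^ 3 * (u i * link_sum E i u)) \<Longrightarrow>
      e \<in> E \<Longrightarrow> i \<in> e \<Longrightarrow> j \<in> e \<Longrightarrow> w i / u i = w j / u j"
proof -
  let ?l = "\<lambda>e. 3 * (\<Prod>i\<in>e. w i)"
  let ?r = "\<lambda>e. (\<Sum>i\<in>e. (w i / u i) ^ 3) * (\<Prod>i\<in>e. u i)"
  note fin = triple_system_finite[OF E]
  have card: "card e = 3" and sub: "e \<subseteq> V" if "e \<in> E" for e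
    using E that by (auto simp: triple_system_def)
  have pos: "w i / u i > 0" if "e \<in> E" "i \<in> e" for e i
    using u[of i] w[of i] sub[OF that(1)] that(2) by auto
  have upos: "(\<Prod>i\<in>e. u i) > 0" if "e \<in> E" for e
    using u sub[OF that] by (intro prod_pos) auto
  have l: "?l e = 3 * (\<Prod>i\<in>e. w i / u i) * (\<Prod>i\<in>e. u i)" if "e \<in> E" for e
    using upos[OF that] by (simp add: prod_dividef)
  have le: "?l e \<le> ?r e" if "e \<in> E" for e
    unfolding l[OF that]
    using three_prod_le_sum_cubes(1)[OF card, of e "\<lambda>i. w i / u i"] pos that upos[OF that]
    by (intro mult_right_mono) auto
  have lhs: "3 * edge_sum E w = sum ?l E"
    by (simp add: edge_sum_def sum_distrib_left)
  have rhs: "(\<Sum>i\<in>V. (w i / u i) ^ 3 * (u i * link_sum E i u)) = sum ?r E"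
    by (rule sum_mult_link_sum[OF E])
  show "3 * edge_sum E w \<le> (\<Sum>i\<in>V. (w i / u i) ^ 3 * (u i * link_sum E i u))"
    unfolding lhs rhs by (intro sum_mono le)
  assume "3 * edge_sum E w = (\<Sum>i\<in>V. (w i / u i) ^ 3 * (u i * link_sum E i u))"
    and e: "e \<in> E" "i \<in> e" "j \<in> e"
  then have "sum ?l E = sum ?r E" by (simp only: lhs rhs)
  then have "?l e = ?r e"
    using sum_mono_inv[of ?l E ?r] le fin(2) e(1) by blast
  then have "3 * (\<Prod>i\<in>e. w i / u i) = (\<Sum>i\<in>e. (w i / u i) ^ 3)"
    using l[OF e(1)] upos[OF e(1)] by simp
  then show "w i / u i = w j / u j"
    using three_prod_le_sum_cubes(2)[OF card, of e "\<lambda>i. w i / u i" i j] pos e by auto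
qed

text \<open>Positive solutions of the system with forcing \<open>k\<close> maximise
  \<open>edge_sum E w + (\<Sum>i. k i * w i) - l / 3 * (\<Sum>i. w i ^ 3)\<close>, which is strictly concave in \<open>w i ^ 3\<close>.\<close>

lemma forced_system_unique_maximiser:
  fixes u w k :: "nat \<Rightarrow> real"
  assumes E: "triple_system V E" and u: "\<And>i. i \<in> V \<Longrightarrow> u i > 0" and w: "\<And>i. i \<in> V \<Longrightarrow> w i > 0"
    and k: "\<And>i. i \<in> V \<Longrightarrow> k i > 0"
    and sol: "\<And>i. i \<in> V \<Longrightarrow> link_sum E i u + k i = l * (u i)\<^sup>2"
    and edge: "edge_sum E w = edge_sum E u"
    and cubes: "(\<Sum>i\<in>V. w i ^ 3) = (\<Sum>i\<in>V. u i ^ 3)"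
    and forcing: "(\<Sum>i\<in>V. k i * w i) = (\<Sum>i\<in>V. k i * u i)"
    and "i \<in> V"
  shows "w i = u i"
proof -
  note fin = triple_system_finite[OF E]
  let ?r = "\<lambda>i. w i / u i"
  have "(?r i) ^ 3 * (u i * link_sum E i u) = l * w i ^ 3 - k i * u i * (?r i) ^ 3" if "i \<in> V" for i
  proof -
    have eq: "link_sum E i u = l * (u i)\<^sup>2 - k i" using sol[OF that] by simp
    show ?thesis
      unfolding eq using u[OF that] by (simp add: field_simps power2_eq_square power3_eq_cube)
  qed
  then have "(\<Sum>i\<in>V. (?r i) ^ 3 * (u i * link_sum E i u)) =
      (\<Sum>i\<in>V. l * w i ^ 3 - k i * u i * (?r i) ^ 3)"
    by (rule sum.cong[OF refl])
  then have "3 * edge_sum E w \<le> (\<Sum>i\<in>V. l * w i ^ 3 - k i * u i * (?r i) ^ 3)"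
    using edge_sum_le_link_sum(1)[of V E u w, OF E u w] by simp
  moreover have "u i * link_sum E i u = l * u i ^ 3 - k i * u i" if "i \<in> V" for i
  proof -
    have eq: "link_sum E i u = l * (u i)\<^sup>2 - k i" using sol[OF that] by simp
    show ?thesis unfolding eq by (simp add: field_simps power2_eq_square power3_eq_cube)
  qed
  then have "(\<Sum>i\<in>V. u i * link_sum E i u) = (\<Sum>i\<in>V. l * u i ^ 3 - k i * u i)"
    by (rule sum.cong[OF refl])
  then have "3 * edge_sum E u = (\<Sum>i\<in>V. l * u i ^ 3 - k i * u i)"
    using sum_link_sum_eq_edge_sum[OF E, of u] by simp
  ultimately have "(\<Sum>i\<in>V. k i * u i * (?r i) ^ 3) \<le> (\<Sum>i\<in>V. k i * u i)"
    using edge cubes by (simp add: sum_subtractf flip: sum_distrib_left)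
  \<comment> \<open>\<open>3 * t - 2\<close> is the tangent line of \<open>t ^ 3\<close> at 1. Its
    weighted sum over the ratios is unchanged when all ratios become 1, because the forcing sums of
    \<open>w\<close> and \<open>u\<close> agree; convexity then forces each ratio to be 1.\<close>
  moreover have ri: "k i * u i * (3 * ?r i - 2) = 3 * (k i * w i) - 2 * (k i * u i)" if "i \<in> V" for i
    using u[OF that] by (simp add: field_simps)
  then have "(\<Sum>i\<in>V. k i * u i * (3 * ?r i - 2)) = (\<Sum>i\<in>V. 3 * (k i * w i) - 2 * (k i * u i))"
    by (intro sum.cong) auto
  then have "(\<Sum>i\<in>V. k i * u i * (3 * ?r i - 2)) = (\<Sum>i\<in>V. k i * u i)"
    using forcing by (simp add: sum_subtractf flip: sum_distrib_left)
  moreover have cub: "t ^ 3 - (3 * t - 2) = (t - 1)\<^sup>2 * (t + 2)" for t :: real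
    by (simp add: algebra_simps power2_eq_square power3_eq_cube)
  have le: "k i * u i * (3 * ?r i - 2) \<le> k i * u i * (?r i) ^ 3" if "i \<in> V" for i
  proof (rule mult_left_mono)
    have "?r i > 0" using u[OF that] w[OF that] by simp
    then show "3 * ?r i - 2 \<le> (?r i) ^ 3"
      using cub[of "?r i"] zero_le_power2[of "?r i - 1"]
      by (smt (verit) mult_nonneg_nonneg)
    show "0 \<le> k i * u i" using k[OF that] u[OF that] by simp
  qed
  ultimately have "(\<Sum>i\<in>V. k i * u i * (3 * ?r i - 2)) = (\<Sum>i\<in>V. k i * u i * (?r i) ^ 3)"
    using sum_mono[of V "\<lambda>i. k i * u i * (3 * ?r i - 2)" "\<lambda>i. k i * u i * (?r i) ^ 3"]
    by fastforce
  then have "k i * u i * (3 * ?r i - 2) = k i * u i * (?r i) ^ 3"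
    using sum_mono_inv[of _ V] le fin(1) \<open>i \<in> V\<close> by blast
  moreover have "k i \<noteq> 0" "u i \<noteq> 0" using k u \<open>i \<in> V\<close> by force+
  ultimately have "(?r i - 1)\<^sup>2 * (?r i + 2) = 0" using cub[of "?r i"] by simp
  moreover have "?r i + 2 > 0" using u w \<open>i \<in> V\<close> by (simp add: add_pos_pos)
  ultimately have "?r i = 1" by simp
  then show ?thesis using u[OF \<open>i \<in> V\<close>] by simp
qed

section \<open>Perron vectors\<close>

text \<open>The real form of a principal eigenpair in rank 3, with links as real sums instead of
  evaluated formal derivatives; \<open>principal_eigenvalue_eq\<close> makes the connection.\<close>

definition perron_pair :: "nat set \<Rightarrow> nat set set \<Rightarrow> real \<Rightarrow> (nat \<Rightarrow> real) \<Rightarrow> bool" where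
  "perron_pair V E l v \<longleftrightarrow>
     (\<forall>i\<in>V. v i > 0) \<and> (\<Sum>i\<in>V. v i ^ 3) = 1 \<and> (\<forall>i\<in>V. link_sum E i v = l * (v i)\<^sup>2)"

lemma perron_pair_edge_sum:
  assumes "triple_system V E" "perron_pair V E l v"
  shows "3 * edge_sum E v = l"
proof -
  have "(\<Sum>i\<in>V. v i * link_sum E i v) = (\<Sum>i\<in>V. l * v i ^ 3)"
    using assms(2) by (intro sum.cong) (auto simp: perron_pair_def power2_eq_square power3_eq_cube)
  then show ?thesis
    using sum_link_sum_eq_edge_sum[OF assms(1), of v] assms(2)
    by (simp add: perron_pair_def flip: sum_distrib_left)
qed

lemma perron_pair_bound_eq:
  assumes "perron_pair V E l v"
  shows "(\<Sum>i\<in>V. (w i / v i) ^ 3 * (v i * link_sum E i v)) = l * (\<Sum>i\<in>V. w i ^ 3)"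
  unfolding sum_distrib_left
  by (rule sum.cong)
    (use assms in \<open>auto simp: perron_pair_def field_simps power2_eq_square power3_eq_cube\<close>)

lemma perron_pair_max:
  assumes "triple_system V E" "perron_pair V E l v" "\<And>i. i \<in> V \<Longrightarrow> w i > 0"
  shows "3 * edge_sum E w \<le> l * (\<Sum>i\<in>V. w i ^ 3)"
  using edge_sum_le_link_sum(1)[OF assms(1), of v w] assms(2,3)
  by (simp add: perron_pair_bound_eq) (simp add: perron_pair_def)

lemma perron_pair_unique_eigenvalue:
  assumes "triple_system V E" "perron_pair V E l v" "perron_pair V E m w"
  shows "l = m"
proof -
  have "3 * edge_sum E w \<le> l" "3 * edge_sum E v \<le> m"
    using perron_pair_max[OF assms(1,2), of w] perron_pair_max[OF assms(1,3), of v] assms(2,3)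
    by (auto simp: perron_pair_def)
  then show ?thesis
    using perron_pair_edge_sum[OF assms(1,2)] perron_pair_edge_sum[OF assms(1,3)] by simp
qed

text \<open>Here \<open>w\<close> also attains the maximum, so the ratio \<open>w i / v i\<close> is
  constant along every edge. Each vertex shares an edge with \<open>z\<close>, where the ratio is 1.
  It is applied with \<open>w\<close> the reflected vector and \<open>z\<close> the fixed
  apex.\<close>

lemma perron_pair_symmetric:
  assumes E: "triple_system V E" and v: "perron_pair V E l v"
    and star: "\<And>i. i \<in> V \<Longrightarrow> \<exists>e\<in>E. z \<in> e \<and> i \<in> e" and "z \<in> V"
    and w: "\<And>i. i \<in> V \<Longrightarrow> w i > 0" and cubes: "(\<Sum>i\<in>V. w i ^ 3) = 1"
    and edge: "edge_sum E w = edge_sum E v" and "w z = v z" and "i \<in> V"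
  shows "w i = v i"
proof -
  have vpos: "\<And>i. i \<in> V \<Longrightarrow> v i > 0" using v by (simp add: perron_pair_def)
  obtain e where e: "e \<in> E" "z \<in> e" "i \<in> e" using star \<open>i \<in> V\<close> by blast
  have "3 * edge_sum E w = (\<Sum>i\<in>V. (w i / v i) ^ 3 * (v i * link_sum E i v))"
    using perron_pair_edge_sum[OF E v] edge cubes by (simp add: perron_pair_bound_eq[OF v])
  then have "w i / v i = w z / v z"
    using edge_sum_le_link_sum(2)[of V E v w, OF E vpos w] e by blast
  then show ?thesis
    using vpos[OF \<open>z \<in> V\<close>] vpos[OF \<open>i \<in> V\<close>] \<open>w z = v z\<close> by simp
qed

section \<open>Existence of Perron pairs\<close>

lemma edge_sum_scale:
  assumes "triple_system V E"
  shows "edge_sum E (\<lambda>i. c * x i) = c ^ 3 * edge_sum E x"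
  unfolding edge_sum_def sum_distrib_left
  by (rule sum.cong) (use assms in \<open>auto simp: triple_system_def prod.distrib\<close>)

lemma continuous_on_edge_sum:
  "continuous_on A (edge_sum E :: (nat \<Rightarrow> real) \<Rightarrow> real)"
  unfolding edge_sum_def
  by (intro continuous_on_sum continuous_on_prod)
    (rule continuous_on_subset[OF continuous_on_product_coordinates], simp)

lemma compact_PiE_Icc:
  fixes B :: "nat \<Rightarrow> real"
  shows "compact (PiE UNIV (\<lambda>i. {0..B i}))"
  using compactin_PiE[of "\<lambda>_::nat. euclidean :: real topology" UNIV "\<lambda>i. {0..B i}"]
  by (simp add: euclidean_product_topology)

text \<open>Vectors live on all of \<open>nat\<close>; pinning the coordinates outside
  \<open>V\<close> to 0 makes the feasible set compact as a product of intervals. The maximum is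
  stated in homogeneous form, so that later variations of coordinates require no
  renormalisation.\<close>

lemma edge_sum_maximiser:
  assumes E: "triple_system V E" and "V \<noteq> {}"
  obtains x :: "nat \<Rightarrow> real" and M :: real where
    "\<And>i. i \<in> V \<Longrightarrow> x i \<ge> 0" "(\<Sum>i\<in>V. x i ^ 3) = 1" "edge_sum E x = M"
    "\<And>y. (\<And>i. i \<in> V \<Longrightarrow> y i \<ge> 0) \<Longrightarrow> edge_sum E y \<le> M * (\<Sum>i\<in>V. y i ^ 3)"
proof -
  note fin = triple_system_finite[OF E]
  let ?K = "PiE UNIV (\<lambda>i. {0..if i \<in> V then 1 else 0 :: real}) \<inter> {x. (\<Sum>i\<in>V. x i ^ 3) = 1}"
  have "closed {x :: nat \<Rightarrow> real. (\<Sum>i\<in>V. x i ^ 3) = 1}"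
    by (intro closed_Collect_eq continuous_intros continuous_on_product_coordinates)
  then have K: "compact ?K"
    by (intro compact_Int_closed compact_PiE_Icc)
  have "?K \<noteq> {}"
  proof -
    obtain a where "a \<in> V" using \<open>V \<noteq> {}\<close> by blast
    then have "(\<lambda>i. if i = a then 1 else 0) \<in> ?K"
      using fin(1) by (auto simp: PiE_def Pi_def if_distrib[of "\<lambda>t. t ^ 3"] cong: if_cong)
    then show ?thesis by blast
  qed
  from continuous_attains_sup[OF K this continuous_on_edge_sum[of _ E]]
  obtain x where x: "x \<in> ?K" and max: "\<And>y. y \<in> ?K \<Longrightarrow> edge_sum E y \<le> edge_sum E x"
    by (elim bexE) (simp only: Ball_def)
  show ?thesis
  proof (rule that[of x "edge_sum E x"])
    show "x i \<ge> 0" if "i \<in> V" for i using x by (auto simp: PiE_def Pi_def)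
    show "(\<Sum>i\<in>V. x i ^ 3) = 1" using x by simp
    fix y :: "nat \<Rightarrow> real" assume y: "\<And>i. i \<in> V \<Longrightarrow> y i \<ge> 0"
    let ?s = "\<Sum>i\<in>V. y i ^ 3"
    have s: "?s \<ge> 0" using y by (intro sum_nonneg) auto
    show "edge_sum E y \<le> edge_sum E x * ?s"
    proof (cases "?s = 0")
      case True
      then have y0: "y i = 0" if "i \<in> V" for i
        using sum_nonneg_eq_0_iff[OF fin(1), of "\<lambda>i. y i ^ 3"] y that by auto
      have "(\<Prod>i\<in>e. y i) = 0" if "e \<in> E" for e
      proof -
        have "e \<subseteq> V" "card e = 3" "finite e"
          using E that fin by (auto simp: triple_system_def)
        then show ?thesis using y0 by (metis card.empty ex_in_conv prod_zero subsetD zero_neq_numeral)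
      qed
      then show ?thesis using True by (simp add: edge_sum_def)
    next
      case False
      \<comment> \<open>Scaling by \<open>c\<close> puts \<open>y\<close> on the unit sphere of the
        3-norm, where the compactness argument applies.\<close>
      define c where "c = inverse (root 3 ?s)"
      have c: "c > 0" "c ^ 3 * ?s = 1"
        using False s by (auto simp: c_def power_inverse field_simps odd_real_root_pow)
      define w where "w i = (if i \<in> V then c * y i else 0)" for i
      have w1: "(\<Sum>i\<in>V. w i ^ 3) = 1"
        using c(2) by (simp add: w_def power_mult_distrib sum_distrib_left)
      have w0: "w i \<ge> 0" for i using y c(1) by (simp add: w_def)
      have "w i \<le> 1" if "i \<in> V" for i
      proof -
        have "w i ^ 3 \<le> (\<Sum>i\<in>V. w i ^ 3)"
          using that fin(1) w0 by (intro member_le_sum) auto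
        then show ?thesis
          using w1 power_le_imp_le_base[of "w i" 2 1] by (simp add: numeral_eq_Suc)
      qed
      then have "w \<in> ?K" using w0 w1 by (auto simp: PiE_def Pi_def w_def)
      then have "edge_sum E w \<le> edge_sum E x" by (rule max)
      moreover have "edge_sum E w = edge_sum E (\<lambda>i. c * y i)"
        using fin(4) by (intro edge_sum_cong) (auto simp: w_def)
      ultimately have "c ^ 3 * edge_sum E y \<le> edge_sum E x" by (simp add: edge_sum_scale[OF E])
      then have "?s * (c ^ 3 * edge_sum E y) \<le> ?s * edge_sum E x"
        using s by (rule mult_left_mono)
      moreover have "?s * (c ^ 3 * edge_sum E y) = edge_sum E y"
        using c(2) by (metis mult.assoc mult.commute mult_1)
      ultimately show ?thesis using mult.commute[of "edge_sum E x" ?s] by linarith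
    qed
  qed simp
qed

text \<open>If a maximiser vanished on part of an edge, raising those coordinates to a small \<open>d\<close> would
  increase the polynomial by order at least \<open>d\<^sup>2\<close>, but the constraint only by order \<open>d\<^sup>3\<close>.\<close>

lemma maximiser_positive_on_edge:
  fixes x :: "nat \<Rightarrow> real"
  assumes E: "triple_system V E" and x: "\<And>i. i \<in> V \<Longrightarrow> x i \<ge> 0" "(\<Sum>i\<in>V. x i ^ 3) = 1"
    and max: "\<And>y. (\<And>i. i \<in> V \<Longrightarrow> y i \<ge> 0) \<Longrightarrow> edge_sum E y \<le> edge_sum E x * (\<Sum>i\<in>V. y i ^ 3)"
    and e: "e \<in> E" "a \<in> e" "x a > 0" "b \<in> e"
  shows "x b > 0"
proof (rule ccontr)
  assume "\<not> x b > 0"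
  note fin = triple_system_finite[OF E]
  have ce: "card e = 3" "e \<subseteq> V" "finite e" using E e fin by (auto simp: triple_system_def)
  define Z where "Z = {i \<in> e. x i = 0}"
  define p where "p = (\<Prod>i\<in>e - Z. x i)"
  define M where "M = edge_sum E x"
  have "b \<in> Z" using \<open>\<not> x b > 0\<close> x(1)[of b] e ce by (force simp: Z_def)
  have Z: "Z \<subseteq> e - {a}" using e by (auto simp: Z_def)
  \<comment> \<open>Since \<open>x a\<close> is positive, at most two coordinates of the edge
    vanish; hence raising them to \<open>d\<close> gains at least
    \<open>p * d\<^sup>2\<close>.\<close>
  then have cZ: "card Z \<le> 2" "finite Z"
    using card_mono[OF _ Z] ce e finite_subset[OF Z] by auto
  have p: "p > 0" unfolding p_def using x(1) ce by (intro prod_pos) (force simp: Z_def)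
  have M: "M \<ge> 0" using x(1) fin(4) by (auto simp: M_def edge_sum_def intro!: sum_nonneg prod_nonneg)
  have key: "p * d\<^sup>2 \<le> 2 * M * d ^ 3" if d: "0 < d" "d \<le> 1" for d
  proof -
    define y where "y i = (if i \<in> Z then d else x i)" for i
    have y: "y i \<ge> 0" "x i \<le> y i" if "i \<in> V" for i
      using x(1)[OF that] d by (auto simp: y_def Z_def)
    have "e = Z \<union> (e - Z)" using Z by auto
    then have "(\<Prod>i\<in>e. y i) = (\<Prod>i\<in>Z. y i) * (\<Prod>i\<in>e - Z. y i)"
      using cZ ce by (metis Diff_disjoint finite_Diff prod.union_disjoint)
    also have "\<dots> = d ^ card Z * p" by (simp add: y_def p_def)
    also have "d ^ card Z \<ge> d\<^sup>2" using d cZ by (intro power_decreasing) auto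
    then have "d ^ card Z * p \<ge> p * d\<^sup>2" using p by simp
    finally have pe: "p * d\<^sup>2 \<le> (\<Prod>i\<in>e. y i)" .
    have "(\<Prod>i\<in>e. x i) = 0" using \<open>b \<in> Z\<close> ce by (auto simp: Z_def)
    moreover have "(\<Sum>f\<in>E - {e}. \<Prod>i\<in>f. x i) \<le> (\<Sum>f\<in>E - {e}. \<Prod>i\<in>f. y i)"
      using x(1) y(2) fin(4) by (intro sum_mono prod_mono) auto
    ultimately have "M + p * d\<^sup>2 \<le> edge_sum E y"
      using pe fin(2) e by (simp add: M_def edge_sum_def sum.remove[of E e])
    also have "\<dots> \<le> M * (\<Sum>i\<in>V. y i ^ 3)" unfolding M_def using y by (intro max)
    also have "(\<Sum>i\<in>V. y i ^ 3) = (\<Sum>i\<in>V. x i ^ 3 + (if i \<in> Z then d ^ 3 else 0))"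
      by (rule sum.cong) (auto simp: y_def Z_def)
    also have "\<dots> = 1 + card Z * d ^ 3"
    proof -
      have "V \<inter> Z = Z" using Z ce by auto
      then show ?thesis using x(2) fin(1) by (simp add: sum.distrib flip: sum.inter_restrict)
    qed
    also have "M * (1 + card Z * d ^ 3) \<le> M * (1 + 2 * d ^ 3)"
      using M cZ d by (intro mult_left_mono) auto
    finally show ?thesis by (simp add: algebra_simps)
  qed
  \<comment> \<open>Chosen so that \<open>2 * M * d < p\<close>, against the inequality
    \<open>key\<close> divided by \<open>d\<^sup>2\<close>; the summand 1 keeps the denominator
    positive when \<open>M = 0\<close>.\<close>
  define d where "d = min 1 (p / (4 * M + 1))"
  have d: "0 < d" "d \<le> 1" using p M by (auto simp: d_def)
  have "p \<le> 2 * M * d"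
    using key[OF d] d by (simp add: power2_eq_square power3_eq_cube)
  also have "2 * M * d \<le> 2 * M * (p / (4 * M + 1))"
    using M by (intro mult_left_mono) (auto simp: d_def)
  also have "\<dots> < p" using p M by (simp add: field_simps add_pos_nonneg)
  finally show False by simp
qed

text \<open>A maximiser has some positive coordinate. Positivity spreads along edges, first to
  \<open>z\<close> and from there to every vertex, so the maximum is interior in each coordinate and
  the derivative conditions are the eigenvalue equations with eigenvalue
  \<open>3 * M\<close>.\<close>

lemma perron_pair_exists:
  assumes E: "triple_system V E" and "z \<in> V"
    and star: "\<And>i. i \<in> V \<Longrightarrow> \<exists>e\<in>E. z \<in> e \<and> i \<in> e"
  obtains l v where "perron_pair V E l v"
proof -
  note fin = triple_system_finite[OF E]
  obtain x :: "nat \<Rightarrow> real" and M where x: "\<And>i. i \<in> V \<Longrightarrow> x i \<ge> 0" "(\<Sum>i\<in>V. x i ^ 3) = 1"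
    and M: "edge_sum E x = M"
    and max: "\<And>y. (\<And>i. i \<in> V \<Longrightarrow> y i \<ge> 0) \<Longrightarrow> edge_sum E y \<le> M * (\<Sum>i\<in>V. y i ^ 3)"
    using edge_sum_maximiser[OF E] \<open>z \<in> V\<close> by blast
  have edge: "x b > 0" if "e \<in> E" "a \<in> e" "x a > 0" "b \<in> e" for e a b
    using maximiser_positive_on_edge[of V E x, OF E x] max M that by blast
  have "\<exists>a\<in>V. x a \<noteq> 0" using x(2) by (rule_tac ccontr) simp
  then obtain a where "a \<in> V" "x a > 0" using x(1) by force
  then have "x z > 0" using star edge by blast
  then have pos: "x i > 0" if "i \<in> V" for i using star[OF that] edge by blast
  have "link_sum E i x = 3 * M * (x i)\<^sup>2" if i: "i \<in> V" for i
  proof -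
    \<comment> \<open>\<open>g\<close> is the excess of the edge sum over its homogeneous bound when
      coordinate \<open>i\<close> alone moves to \<open>t\<close>; it is at most 0 for positive
      \<open>t\<close> and vanishes at \<open>x i\<close>.\<close>
    define g where "g t = (t - x i) * link_sum E i x - M * (t ^ 3 - x i ^ 3)" for t
    have "g t \<le> g (x i)" if t: "\<bar>x i - t\<bar> < x i" for t
    proof -
      have "t > 0" using t by linarith
      have "(\<Sum>j\<in>V. (x(i := t)) j ^ 3) = 1 + (t ^ 3 - x i ^ 3)"
        using x(2) i fin(1) by (simp add: sum.remove[of V i])
      moreover have "edge_sum E (x(i := t)) \<le> M * (\<Sum>j\<in>V. (x(i := t)) j ^ 3)"
        using x(1) \<open>t > 0\<close> by (intro max) auto
      ultimately have "edge_sum E (x(i := t)) \<le> M * (1 + (t ^ 3 - x i ^ 3))" by simp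
      then show ?thesis
        using edge_sum_upd[OF fin(2,3), where x = x and i = i and t = t] M
        by (simp add: g_def algebra_simps)
    qed
    moreover have "(g has_real_derivative link_sum E i x - 3 * M * (x i)\<^sup>2) (at (x i))"
      unfolding g_def by (auto intro!: derivative_eq_intros)
    ultimately have "link_sum E i x - 3 * M * (x i)\<^sup>2 = 0"
      using pos[OF i] by (intro DERIV_local_max) auto
    then show ?thesis by simp
  qed
  with pos x(2) have "perron_pair V E (3 * M) x" by (simp add: perron_pair_def)
  then show ?thesis by (rule that)
qed

section \<open>From formal derivatives to the principal eigenvalue\<close>

lemma partial_deriv_add:
  "partial_deriv i (p + q) = partial_deriv i p + partial_deriv i q"
  unfolding partial_deriv_def
  by (rule setsum_keys_plus_distrib) (simp_all add: algebra_simps single_add)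

lemma partial_deriv_sum:
  "partial_deriv i (sum f A) = (\<Sum>a\<in>A. partial_deriv i (f a))"
proof (induction A rule: infinite_finite_induct)
  case (insert a A)
  then show ?case by (simp add: partial_deriv_add)
qed (simp_all add: partial_deriv_def)

lemma partial_deriv_prod_Var:
  assumes "finite e"
  shows "partial_deriv i (\<Prod>j\<in>e. Var j :: 'a::comm_semiring_1 mpoly) =
    (if i \<in> e then \<Prod>j\<in>e - {i}. Var j else 0)"
proof -
  let ?m = "\<lambda>e. \<Sum>j\<in>e. Poly_Mapping.single j (1::nat)"
  have "partial_deriv i (\<Prod>j\<in>e. Var j :: 'a mpoly) =
      Poly_Mapping.single (?m e - Poly_Mapping.single i 1) (of_nat (if i \<in> e then 1 else 0))"
    by (simp add: prod_Var partial_deriv_def lookup_sum_single[OF assms, simplified])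
  moreover have "?m e - Poly_Mapping.single i 1 = ?m (e - {i})" if "i \<in> e"
    using assms that by (simp add: sum.remove[of e i])
  ultimately show ?thesis by (simp add: prod_Var)
qed

lemma eval_at_link:
  assumes "triple_system V E"
  shows "eval_at (\<lambda>i. complex_of_real (x i)) (link (V, E) i) = complex_of_real (link_sum E i x)"
proof -
  note fin = triple_system_finite[OF assms]
  have "link (V, E) i = (\<Sum>e\<in>E. if i \<in> e then \<Prod>j\<in>e - {i}. Var j else 0)"
    unfolding link_def lagrangian_def partial_deriv_sum snd_conv
    by (rule sum.cong) (use fin in \<open>auto simp: partial_deriv_prod_Var\<close>)
  also have "\<dots> = (\<Sum>e | e \<in> E \<and> i \<in> e. \<Prod>j\<in>e - {i}. Var j)"
    using fin(2) by (simp add: sum.inter_filter)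
  finally have *: "link (V, E) i = (\<Sum>e | e \<in> E \<and> i \<in> e. \<Prod>j\<in>e - {i}. Var j)" .
  have prod: "mpoly_hom (\<lambda>c. c) \<sigma> (\<Prod>j\<in>e. Var j) = (\<Prod>j\<in>e. \<sigma> j)"
    for \<sigma> :: "nat \<Rightarrow> complex" and e
    by (induction e rule: infinite_finite_induct)
      (simp_all add: mpoly_hom_mult mpoly_hom_Var mpoly_hom_single flip: single_one)
  show ?thesis
    unfolding * eval_at_def by (simp add: mpoly_hom_sum prod link_sum_def)
qed

text \<open>An eigenvalue with a positive real eigenvector is a quotient of a real link by a real
  square, hence real. Uniqueness of the eigenvalue of a Perron pair then resolves the definite
  description.\<close>

lemma principal_eigenvalue_eq:
  assumes E: "triple_system V E" and v: "perron_pair V E l v" and "V \<noteq> {}"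
  shows "principal_eigenvalue 3 (V, E) = complex_of_real l"
proof -
  have uni: "uniform 3 (V, E)"
    using E triple_system_finite[OF E] by (auto simp: triple_system_def uniform_def)
  have iff: "principal_eigenpair 3 (V, E) k w \<longleftrightarrow>
      (\<exists>m. k = complex_of_real m \<and> perron_pair V E m w)" for k w
  proof
    assume w: "principal_eigenpair 3 (V, E) k w"
    then have link: "complex_of_real (link_sum E i w) = k * complex_of_real ((w i)\<^sup>2)" if "i \<in> V" for i
      using that by (auto simp: principal_eigenpair_def eigenpair_def eval_at_link[OF E])
    have pos: "w i > 0" if "i \<in> V" for i using w that by (auto simp: principal_eigenpair_def)
    obtain a where "a \<in> V" using \<open>V \<noteq> {}\<close> by blast
    then have "k = complex_of_real (link_sum E a w / (w a)\<^sup>2)"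
      using link[of a] pos[of a] by (simp add: field_simps)
    then obtain m where m: "k = complex_of_real m" by blast
    have "link_sum E i w = m * (w i)\<^sup>2" if "i \<in> V" for i
      using link[OF that] unfolding m of_real_mult[symmetric] of_real_eq_iff .
    then show "\<exists>m. k = complex_of_real m \<and> perron_pair V E m w"
      using m w by (auto simp: perron_pair_def principal_eigenpair_def)
  next
    assume "\<exists>m. k = complex_of_real m \<and> perron_pair V E m w"
    then show "principal_eigenpair 3 (V, E) k w"
      using uni \<open>V \<noteq> {}\<close>
      by (fastforce simp: principal_eigenpair_def eigenpair_def perron_pair_def eval_at_link[OF E])
  qed
  show ?thesis
    unfolding principal_eigenvalue_def iff
  proof (rule the_equality)
    show "\<exists>w m. complex_of_real l = complex_of_real m \<and> perron_pair V E m w" using v by blast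
    fix k assume "\<exists>w m. k = complex_of_real m \<and> perron_pair V E m w"
    then show "k = complex_of_real l"
      using perron_pair_unique_eigenvalue[OF E v] by blast
  qed
qed

section \<open>The edges of the hypergraph with Lagrangian \<open>\<Gamma>\<close>\<close>

text \<open>The usual blow-up: vertex \<open>i\<close> becomes the class \<open>C i\<close>, and an
  edge \<open>t\<close> becomes all its transversals, given by choice functions \<open>g\<close> on
  \<open>t\<close>. For disjoint classes it realises the substitution of class sums for
  variables.\<close>

definition blow_up :: "(nat \<Rightarrow> nat set) \<Rightarrow> nat set set \<Rightarrow> nat set set" where
  "blow_up C E = (\<Union>t\<in>E. (\<lambda>g. g ` t) ` PiE t C)"

lemma transversal_eq:
  assumes "disjoint_family_on C U" "t \<subseteq> U" "g \<in> PiE t C"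
  shows "t = {i \<in> U. g ` t \<inter> C i \<noteq> {}}"
    and "inj_on g t"
    and "i \<in> t \<Longrightarrow> g ` t \<inter> C i = {g i}"
proof -
  have *: "i = j" if "i \<in> U" "j \<in> t" "g j \<in> C i" for i j
    using assms that by (fastforce simp: disjoint_family_on_def)
  then show "t = {i \<in> U. g ` t \<inter> C i \<noteq> {}}"
    using assms(2,3) by fastforce
  show "inj_on g t"
    using * assms(2,3) by (metis PiE_mem inj_onI subsetD)
  assume "i \<in> t"
  then show "g ` t \<inter> C i = {g i}"
    using * assms(2,3) by (auto simp: PiE_mem)
qed

lemma triple_system_blow_up:
  assumes E: "triple_system U E" and C: "disjoint_family_on C U" "\<And>i. i \<in> U \<Longrightarrow> C i \<subseteq> V"
    and "finite V"
  shows "triple_system V (blow_up C E)"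
  unfolding triple_system_def
proof (intro conjI ballI)
  fix e assume "e \<in> blow_up C E"
  then obtain t g where e: "t \<in> E" "g \<in> PiE t C" "e = g ` t"
    by (auto simp: blow_up_def)
  have t: "t \<subseteq> U" "card t = 3" using E e(1) by (auto simp: triple_system_def)
  show "e \<subseteq> V" using e t C(2) by (auto simp: PiE_def Pi_def)
  show "card e = 3" using transversal_eq(2)[OF C(1) t(1) e(2)] t e by (simp add: card_image)
qed fact

text \<open>Expanding the products of class sums yields one monomial per pair \<open>(t, g)\<close>.
  By \<open>transversal_eq\<close> different pairs give different edges, so no monomial is counted
  twice.\<close>

lemma edge_sum_blow_up:
  assumes E: "triple_system U E" and C: "disjoint_family_on C U" "\<And>i. i \<in> U \<Longrightarrow> finite (C i)"
  shows "edge_sum (blow_up C E) x = edge_sum E (\<lambda>i. \<Sum>j\<in>C i. x j)"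
proof -
  note fin = triple_system_finite[OF E]
  let ?S = "SIGMA t:E. PiE t C"
  have inj: "inj_on (\<lambda>(t, g). g ` t) ?S"
  proof (rule inj_onI, clarify)
    fix t g t' g'
    assume t: "t \<in> E" "t' \<in> E" and g: "g \<in> PiE t C" "g' \<in> PiE t' C" and eq: "g ` t = g' ` t'"
    have sub: "t \<subseteq> U" "t' \<subseteq> U" using fin(4) t by auto
    have "t = t'"
      using transversal_eq(1)[OF C(1) sub(1) g(1)] transversal_eq(1)[OF C(1) sub(2) g(2)] eq
      by simp
    moreover have "g i = g' i" if "i \<in> t" for i
      using transversal_eq(3)[OF C(1) sub(1) g(1) that] that eq \<open>t = t'\<close>
        transversal_eq(3)[OF C(1) sub(2) g(2), of i] by auto
    ultimately show "t = t' \<and> g = g'"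
      using PiE_ext[of g t C g'] g by auto
  qed
  have "blow_up C E = (\<lambda>(t, g). g ` t) ` ?S" by (auto simp: blow_up_def)
  then have "edge_sum (blow_up C E) x = sum (\<lambda>e. \<Prod>j\<in>e. x j) ((\<lambda>(t, g). g ` t) ` ?S)"
    by (simp only: edge_sum_def)
  also have "\<dots> = (\<Sum>(t, g)\<in>?S. \<Prod>j\<in>g ` t. x j)"
    by (subst sum.reindex[OF inj]) (simp add: case_prod_unfold o_def)
  also have "\<dots> = (\<Sum>t\<in>E. \<Sum>g\<in>PiE t C. \<Prod>j\<in>g ` t. x j)"
    using fin C by (intro sum.Sigma[symmetric] ballI finite_PiE) auto
  also have "\<dots> = (\<Sum>t\<in>E. \<Sum>g\<in>PiE t C. \<Prod>i\<in>t. x (g i))"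
  proof (intro sum.cong refl)
    fix t g assume "t \<in> E" "g \<in> PiE t C"
    then have "inj_on g t" using transversal_eq(2)[OF C(1)] fin(4) by blast
    then show "(\<Prod>j\<in>g ` t. x j) = (\<Prod>i\<in>t. x (g i))" by (simp add: prod.reindex)
  qed
  also have "\<dots> = (\<Sum>t\<in>E. \<Prod>i\<in>t. \<Sum>j\<in>C i. x j)"
    using fin C by (intro sum.cong refl prod_sum_PiE[symmetric]) auto
  finally show ?thesis by (simp add: edge_sum_def)
qed

definition set_of_triple :: "nat \<times> nat \<times> nat \<Rightarrow> nat set" where
  "set_of_triple = (\<lambda>(i, j, k). {i, j, k})"

text \<open>Increasing triples are the sorted lists of their sets, so distinct triples give distinct
  edges.\<close>

lemma edge_sum_triples:
  assumes "finite T" "\<And>i j k. (i, j, k) \<in> T \<Longrightarrow> i < j \<and> j < k"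
  shows "edge_sum (set_of_triple ` T) x = (\<Sum>(i, j, k)\<in>T. x i * x j * x k)"
proof -
  have inj: "inj_on set_of_triple T"
  proof (rule inj_onI)
    fix s s' assume s: "s \<in> T" "s' \<in> T" "set_of_triple s = set_of_triple s'"
    obtain i j k i' j' k' where eq: "s = (i, j, k)" "s' = (i', j', k')" by (metis prod_cases3)
    then have "i < j" "j < k" "i' < j'" "j' < k'" using assms(2) s by blast+
    then have "sorted_list_of_set {i, j, k} = [i, j, k]"
      "sorted_list_of_set {i', j', k'} = [i', j', k']"
      by (auto simp: insort_is_Cons sorted_list_of_set_insert_remove)
    moreover have "{i, j, k} = {i', j', k'}" using s(3) by (simp add: eq set_of_triple_def)
    ultimately show "s = s'" by (metis eq list.inject)
  qed
  show ?thesis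
    unfolding edge_sum_def sum.reindex[OF inj]
    by (rule sum.cong) (use assms(2) in \<open>fastforce simp: set_of_triple_def mult.assoc\<close>)+
qed

section \<open>Residue classes and the edge sets of the recursion\<close>

definition residue_class :: "nat \<Rightarrow> nat \<Rightarrow> nat \<Rightarrow> nat set" where
  "residue_class n r k = {j. j \<in> {1..2 ^ n} \<and> j mod 2 ^ r = k mod 2 ^ r}"

definition class_sum :: "nat \<Rightarrow> nat \<Rightarrow> (nat \<Rightarrow> 'a::comm_monoid_add) \<Rightarrow> nat \<Rightarrow> 'a" where
  "class_sum n r x k = (\<Sum>j\<in>residue_class n r k. x j)"

text \<open>The 16 edges of \<open>G33\<close>: first the cyclically consecutive triples modulo 8,
  then the triples \<open>i - 3, i, i + 3\<close> modulo 8, each written in increasing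
  order.\<close>

definition octets :: "nat set set" where
  "octets = set_of_triple ` {(1,2,3), (2,3,4), (3,4,5), (4,5,6), (5,6,7), (6,7,8), (1,7,8), (1,2,8),
     (1,4,6), (2,5,7), (3,6,8), (1,4,7), (2,5,8), (1,3,6), (2,4,7), (3,5,8)}"

text \<open>\<open>gamma_edges m\<close> is the edge set with Lagrangian \<open>\<Gamma>\<^bsub>m+3\<^esub>\<close>.\<close>

primrec gamma_edges :: "nat \<Rightarrow> nat set set" where
  "gamma_edges 0 = set_of_triple ` {(1,3,5), (2,4,6), (3,5,7), (4,6,8)} \<union> octets"
| "gamma_edges (Suc m) =
     blow_up (\<lambda>i. {2 * i}) (gamma_edges m) \<union> blow_up (\<lambda>i. {2 * i - 1}) (gamma_edges m) \<union>
     blow_up (residue_class (m + 4) 3) octets"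

declare gamma_edges.simps [simp del]

lemma edge_sum_octets:
  "edge_sum octets x =
    x 1 * x 2 * x 3 + x 2 * x 3 * x 4 + x 3 * x 4 * x 5 + x 4 * x 5 * x 6 + x 5 * x 6 * x 7 +
    x 6 * x 7 * x 8 + x 1 * x 7 * x 8 + x 1 * x 2 * x 8 + x 1 * x 4 * x 6 + x 2 * x 5 * x 7 +
    x 3 * x 6 * x 8 + x 1 * x 4 * x 7 + x 2 * x 5 * x 8 + x 1 * x 3 * x 6 + x 2 * x 4 * x 7 +
    x 3 * x 5 * x 8"
  unfolding octets_def by (subst edge_sum_triples) (auto simp: add.assoc)

lemma triple_system_octets: "triple_system {1..8} octets"
  by (auto simp: triple_system_def octets_def set_of_triple_def)

text \<open>Steps of 1 or 3 change the parity. This separates the new edges of a level from the two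
  copies of the preceding level, which live on indices of a single parity.\<close>

lemma octets_mixed_parity: "t \<in> octets \<Longrightarrow> (\<exists>i\<in>t. even i) \<and> (\<exists>i\<in>t. odd i)"
  by (auto simp: octets_def set_of_triple_def)

lemma disjoint_residue_class: "disjoint_family_on (residue_class n 3) {1..8}"
proof -
  have "i = j" if "i \<in> {1..8}" "j \<in> {1..8}" "i mod 8 = j mod 8" for i j :: nat
    using that by (cases "i = 8"; cases "j = 8") auto
  then show ?thesis by (auto simp: disjoint_family_on_def residue_class_def)
qed

lemma residue_class_subset: "residue_class n r k \<subseteq> {1..2 ^ n}" and finite_residue_class: "finite (residue_class n r k)"
  by (auto simp: residue_class_def)

lemma disjoint_double: "disjoint_family_on (\<lambda>i. {2 * i :: nat}) {1..N}"
  and disjoint_double_minus: "disjoint_family_on (\<lambda>i. {2 * i - 1 :: nat}) {1..N}"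
  by (auto simp: disjoint_family_on_def)

lemma triple_system_gamma_edges: "triple_system {1..2 ^ (m + 3)} (gamma_edges m)"
proof (induction m)
  case 0
  then show ?case
    using triple_system_octets
      by (auto simp: triple_system_def set_of_triple_def gamma_edges.simps)
next
  case (Suc m)
  have "triple_system {1..2 ^ (Suc m + 3)} (blow_up (\<lambda>i. {2 * i}) (gamma_edges m))"
    by (rule triple_system_blow_up[OF Suc disjoint_double]) (auto simp: power_add)
  moreover have "triple_system {1..2 ^ (Suc m + 3)} (blow_up (\<lambda>i. {2 * i - 1}) (gamma_edges m))"
    by (rule triple_system_blow_up[OF Suc disjoint_double_minus]) (auto simp: power_add)
  moreover have "triple_system {1..2 ^ (Suc m + 3)} (blow_up (residue_class (m + 4) 3) octets)"
  proof (rule triple_system_blow_up[OF triple_system_octets disjoint_residue_class])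
    show "residue_class (m + 4) 3 i \<subseteq> {1..2 ^ (Suc m + 3)}" for i
      using residue_class_subset[of "m + 4" 3 i] by (simp add: add.commute)
  qed simp
  ultimately show ?case by (auto simp: triple_system_def gamma_edges.simps)
qed

lemma edge_sum_gamma_0:
  "edge_sum (gamma_edges 0) x =
    x 1 * x 3 * x 5 + x 2 * x 4 * x 6 + x 3 * x 5 * x 7 + x 4 * x 6 * x 8 + edge_sum octets x"
proof -
  let ?T = "{(1,3,5), (2,4,6), (3,5,7), (4,6,8)} :: (nat \<times> nat \<times> nat) set"
  have "(\<forall>i\<in>t. even i) \<or> (\<forall>i\<in>t. odd i)" if "t \<in> set_of_triple ` ?T" for t
    using that by (auto simp: set_of_triple_def)
  then have "set_of_triple ` ?T \<inter> octets = {}"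
    using octets_mixed_parity by blast
  moreover have "edge_sum (set_of_triple ` ?T) x =
      x 1 * x 3 * x 5 + x 2 * x 4 * x 6 + x 3 * x 5 * x 7 + x 4 * x 6 * x 8"
    by (subst edge_sum_triples) (auto simp: add.assoc)
  ultimately show ?thesis
    unfolding gamma_edges.simps
    by (subst edge_sum_Un) (simp_all only: triple_system_finite(2)[OF triple_system_octets]
        finite_imageI finite.intros)
qed

lemma edge_sum_gamma_Suc:
  "edge_sum (gamma_edges (Suc m)) x =
    edge_sum (gamma_edges m) (\<lambda>i. x (2 * i)) + edge_sum (gamma_edges m) (\<lambda>i. x (2 * i - 1)) +
    edge_sum octets (class_sum (m + 4) 3 x)"
proof -
  let ?A = "blow_up (\<lambda>i. {2 * i}) (gamma_edges m)"
  let ?B = "blow_up (\<lambda>i. {2 * i - 1}) (gamma_edges m)"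
  let ?C = "blow_up (residue_class (m + 4) 3) octets"
  note G = triple_system_gamma_edges
  have "finite (gamma_edges (Suc m))" by (rule triple_system_finite(2)[OF G])
  then have fin: "finite ?A" "finite ?B" "finite ?C" by (auto simp: gamma_edges.simps)
  \<comment> \<open>Nonemptiness matters: the empty set would have both parities vacuously.\<close>
  have A: "(\<forall>i\<in>e. even i) \<and> e \<noteq> {}" if "e \<in> ?A" for e
  proof -
    have "card e = 3" using that G[of "Suc m"] by (auto simp: triple_system_def gamma_edges.simps)
    then show ?thesis using that by (fastforce simp: blow_up_def PiE_def Pi_def)
  qed
  have B: "\<forall>i\<in>e. odd i" if mem: "e \<in> ?B" for e
  proof -
    obtain t g where e: "t \<in> gamma_edges m" "g \<in> PiE t (\<lambda>i. {2 * i - 1})" "e = g ` t"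
      using mem by (auto simp: blow_up_def)
    \<comment> \<open>Positive indices are essential for oddness: with truncated subtraction
      \<open>2 * i - 1\<close> is 0 at \<open>i = 0\<close>.\<close>
    then have "t \<subseteq> {1..2 ^ (m + 3)}" using G[of m] by (auto simp: triple_system_def)
    then show ?thesis using e by (fastforce simp: PiE_def Pi_def)
  qed
  have C: "(\<exists>i\<in>e. even i) \<and> (\<exists>i\<in>e. odd i)" if mem: "e \<in> ?C" for e
  proof -
    obtain t g where e: "t \<in> octets" "g \<in> PiE t (residue_class (m + 4) 3)" "e = g ` t"
      using mem by (auto simp: blow_up_def)
    have "even (g i) \<longleftrightarrow> even i" if "i \<in> t" for i
    proof -
      have "g i mod 8 = i mod 8" using e(2) that by (auto simp: residue_class_def PiE_def Pi_def)
      then show ?thesis by presburger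
    qed
    then show ?thesis using octets_mixed_parity[OF e(1)] e(3) by blast
  qed
  have "?A \<inter> ?B = {}" using A B by blast
  moreover have "(?A \<union> ?B) \<inter> ?C = {}" using A B C by blast
  ultimately have "edge_sum (gamma_edges (Suc m)) x = edge_sum ?A x + edge_sum ?B x + edge_sum ?C x"
    using fin by (simp add: edge_sum_Un gamma_edges.simps)
  then show ?thesis
    using edge_sum_blow_up[OF G disjoint_double, of m x]
      edge_sum_blow_up[OF G disjoint_double_minus, of m x]
      edge_sum_blow_up[OF triple_system_octets disjoint_residue_class finite_residue_class, of "m + 4" x]
    by (simp add: class_sum_def[abs_def])
qed

section \<open>Identification of the formal polynomial \<open>Gam\<close> with an edge sum\<close>

lemma subst_add: "subst \<sigma> (p + q) = subst \<sigma> p + subst \<sigma> q"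
  and subst_sum: "subst \<sigma> (sum f A) = (\<Sum>a\<in>A. subst \<sigma> (f a))"
  and subst_mult: "subst \<sigma> (p * q) = subst \<sigma> p * subst \<sigma> q"
  and subst_Var: "subst \<sigma> (Var i) = \<sigma> i"
  and subst_1: "subst \<sigma> 1 = 1"
  unfolding subst_def
  by (simp_all add: mpoly_hom_add mpoly_hom_sum mpoly_hom_mult mpoly_hom_Var mpoly_hom_single
      Const_def single_add mult_single flip: single_one)

lemma subst_edge_sum: "subst \<sigma> (edge_sum E Var) = edge_sum E \<sigma>"
proof -
  have "subst \<sigma> (\<Prod>j\<in>e. Var j) = (\<Prod>j\<in>e. \<sigma> j)" for e
    by (induction e rule: infinite_finite_induct) (simp_all add: subst_mult subst_Var subst_1)
  then show ?thesis by (simp add: edge_sum_def subst_sum)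
qed

lemma G33_eq: "G33 = edge_sum octets Var"
proof -
  have "{1..8::int} = {1, 2, 3, 4, 5, 6, 7, 8}" by auto
  then show ?thesis
    by (simp add: G33_def edge_sum_octets Var_mod_def algebra_simps)
qed

lemma Gam_Suc:
  assumes "n \<ge> 3"
  shows "Gam (Suc n) = p0 (Gam n) + p1 (Gam n) + Ehom 3 (Suc n) G33"
proof -
  have "{2..Suc n} = insert (Suc n) {2..n}" using assms by auto
  then have "Gam (Suc n) = G_poly (Suc n) (Suc n) + (\<Sum>k=2..n. G_poly (Suc n) k)"
    by (simp add: Gam_def)
  also have "G_poly (Suc n) (Suc n) = Ehom 3 (Suc n) G33"
    using assms by (subst G_poly.simps) auto
  also have "(\<Sum>k=2..n. G_poly (Suc n) k) = (\<Sum>k=2..n. p0 (G_poly n k) + p1 (G_poly n k))"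
    by (rule sum.cong) (use assms in \<open>auto simp: G_poly.simps[of "Suc n"]\<close>)
  finally show ?thesis
    by (simp add: Gam_def sum.distrib p0_def p1_def subst_sum algebra_simps)
qed

lemma Gam_eq: "Gam (m + 3) = edge_sum (gamma_edges m) Var"
proof (induction m)
  case 0
  have "{1..4::nat} = {1, 2, 3, 4}" "{2..3::nat} = {2, 3}" by auto
  then show ?case
    by (simp add: Gam_def G_poly.simps[of 3] G33_eq edge_sum_gamma_0 G23_def algebra_simps
        numeral_3_eq_3[symmetric])
next
  case (Suc m)
  have "Ehom 3 (m + 4) G33 = edge_sum octets (class_sum (m + 4) 3 Var)"
    by (simp add: Ehom_def G33_eq subst_edge_sum class_sum_def[abs_def] residue_class_def)
  then show ?case
    using Gam_Suc[of "m + 3"] Suc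
    by (simp add: edge_sum_gamma_Suc p0_def p1_def subst_edge_sum numeral_eq_Suc
       )
qed

section \<open>Residue class sums and reflection\<close>

lemma class_sum_upd:
  fixes x :: "nat \<Rightarrow> real"
  assumes "i \<in> {1..2 ^ n}"
  shows "class_sum n r (x(i := t)) k =
    class_sum n r x k + (if k mod 2 ^ r = i mod 2 ^ r then t - x i else 0)"
proof (cases "k mod 2 ^ r = i mod 2 ^ r")
  case True
  then have "i \<in> residue_class n r k" using assms by (simp add: residue_class_def)
  then show ?thesis
    using True finite_residue_class[of n r k] by (simp add: class_sum_def sum.remove[of _ i])
next
  case False
  then have "i \<notin> residue_class n r k" by (simp add: residue_class_def)
  then have "(\<Sum>j\<in>residue_class n r k. (x(i := t)) j) = (\<Sum>j\<in>residue_class n r k. x j)"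
    by (intro sum.cong) auto
  then show ?thesis using False by (simp add: class_sum_def)
qed

text \<open>As \<open>2 ^ r\<close> divides \<open>2 ^ n\<close>, the reflection of the indices
  induces the reflection of the residues modulo \<open>2 ^ r\<close>. Congruences are computed in
  the integers because of truncated subtraction.\<close>

lemma class_sum_mirror:
  assumes "r \<le> n" "k \<in> {1..2 ^ r}"
  shows "class_sum n r (\<lambda>i. x (2 ^ n + 1 - i)) k = class_sum n r x (2 ^ r + 1 - k)"
proof -
  let ?M = "2 ^ r :: nat" and ?N = "2 ^ n :: nat"
  have *: "(?N + 1 - j) mod ?M = (?M + 1 - i) mod ?M"
    if "j mod ?M = i mod ?M" "j \<le> ?N" "i \<le> ?M" for i j
  proof -
    have "int ?M dvd int ?N" using assms(1) by (simp add: le_imp_power_dvd)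
    then have "(int ?N + 1) mod int ?M = (int ?M + 1) mod int ?M"
      by (metis mod_add_left_eq mod_self dvd_imp_mod_0)
    moreover have "int j mod int ?M = int i mod int ?M" using that(1) by (metis zmod_int)
    ultimately have "(int ?N + 1 - int j) mod int ?M = (int ?M + 1 - int i) mod int ?M"
      by (rule mod_diff_cong)
    then have "int ((?N + 1 - j) mod ?M) = int ((?M + 1 - i) mod ?M)"
      using that by (simp add: zmod_int of_nat_diff add.commute)
    then show ?thesis by linarith
  qed
  have "?N + 1 - j \<in> residue_class n r (?M + 1 - k)" if "j \<in> residue_class n r k" for j
    using that assms(2) *[of j k] by (auto simp: residue_class_def simp del: One_nat_def)
  moreover have "?N + 1 - j \<in> residue_class n r k" if "j \<in> residue_class n r (?M + 1 - k)" for j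
    using that assms(2) *[of j "?M + 1 - k"] by (auto simp: residue_class_def simp del: One_nat_def)
  ultimately show ?thesis
    unfolding class_sum_def
    by (intro sum.reindex_bij_witness[where i = "\<lambda>j. ?N + 1 - j" and j = "\<lambda>j. ?N + 1 - j"])
      (auto simp: residue_class_def)
qed

lemma sum_mirror:
  "(\<Sum>i\<in>{1..N::nat}. f (N + 1 - i)) = (\<Sum>i\<in>{1..N}. f i)"
  by (rule sum.reindex_bij_witness[where i = "\<lambda>j. N + 1 - j" and j = "\<lambda>j. N + 1 - j"]) auto

section \<open>Residue classes under doubling, and their parities\<close>

lemma double_mod_iff:
  "j mod 2 ^ Suc r = (2 * k) mod 2 ^ Suc r \<longleftrightarrow> (\<exists>i. j = 2 * i \<and> i mod 2 ^ r = k mod 2 ^ r)"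
  for j k :: nat
proof
  assume *: "j mod 2 ^ Suc r = (2 * k) mod 2 ^ Suc r"
  then obtain i where "j = 2 * i"
    by (metis dvd_def dvd_mod_iff dvd_power dvd_triv_left zero_less_Suc)
  with * show "\<exists>i. j = 2 * i \<and> i mod 2 ^ r = k mod 2 ^ r" by (simp add: mod_mult_mult1)
qed (auto simp: mod_mult_mult1)

text \<open>Restricting to the even indices lowers the level and the exponent of the modulus by one
  simultaneously; hence classes modulo 8 become classes modulo 4 one level lower.\<close>

lemma residue_class_double:
  "residue_class (Suc n) (Suc r) (2 * k) = (\<lambda>i. 2 * i) ` residue_class n r k"
  unfolding residue_class_def double_mod_iff by auto

lemma residue_class_double_minus:
  assumes "k \<ge> 1"
  shows "residue_class (Suc n) (Suc r) (2 * k - 1) = (\<lambda>i. 2 * i - 1) ` residue_class n r k"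
proof -
  \<comment> \<open>Adding 1 to both sides reduces the odd residue \<open>2 * k - 1\<close> to the
    even residue \<open>2 * k\<close>.\<close>
  have "Suc i mod m = Suc j mod m \<longleftrightarrow> i mod m = j mod m" for i j m :: nat
    by (auto simp: mod_Suc split: if_splits)
  from this[of _ "2 ^ Suc r" "2 * k - 1"]
  have "j mod 2 ^ Suc r = (2 * k - 1) mod 2 ^ Suc r \<longleftrightarrow>
      (\<exists>i. Suc j = 2 * i \<and> i mod 2 ^ r = k mod 2 ^ r)" for j
    using assms double_mod_iff[of "Suc j" r k] by simp
  moreover have "Suc j = 2 * i \<longleftrightarrow> j = 2 * i - 1 \<and> i \<ge> 1" for i j by auto
  ultimately show ?thesis
    unfolding residue_class_def by (auto intro!: image_eqI)
qed

lemma class_sum_double: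
  "class_sum (Suc n) (Suc r) x (2 * k) = class_sum n r (\<lambda>i. x (2 * i)) k"
  by (simp add: class_sum_def residue_class_double sum.reindex inj_on_def)

lemma class_sum_double_minus:
  assumes "k \<ge> 1"
  shows "class_sum (Suc n) (Suc r) x (2 * k - 1) = class_sum n r (\<lambda>i. x (2 * i - 1)) k"
proof -
  have "inj_on (\<lambda>i. 2 * i - 1) (residue_class n r k)"
    by (auto simp: inj_on_def residue_class_def)
  then show ?thesis
    unfolding class_sum_def residue_class_double_minus[OF assms] by (simp add: sum.reindex)
qed

text \<open>Each class modulo 4 splits into two classes modulo 8. Thus balance modulo 4 becomes the
  relation between opposite octet variables used in \<open>link_octets_balanced\<close>.\<close>

lemma class_sum_2_eq_3:
  "class_sum n 2 x k = class_sum n 3 x k + class_sum n 3 x (k + 4)"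
proof -
  have *: "a mod 4 = b mod 4 \<longleftrightarrow> a = b \<or> a = (b + 4) mod 8" if "a < 8" "b < 8" for a b :: nat
  proof -
    have "a \<in> {0, 1, 2, 3, 4, 5, 6, 7}" "b \<in> {0, 1, 2, 3, 4, 5, 6, 7}" using that by auto
    then show ?thesis by (elim insertE emptyE) simp_all
  qed
  have "j mod 4 = k mod 4 \<longleftrightarrow> j mod 8 = k mod 8 \<or> j mod 8 = (k + 4) mod 8" for j
    using *[of "j mod 8" "k mod 8"] by (simp add: mod_mod_cancel mod_add_left_eq)
  then have "residue_class n 2 k = residue_class n 3 k \<union> residue_class n 3 (k + 4)"
    by (auto simp: residue_class_def)
  moreover have "k mod 8 \<noteq> (k + 4) mod 8" by presburger
  then have "residue_class n 3 k \<inter> residue_class n 3 (k + 4) = {}"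
    by (auto simp: residue_class_def)
  ultimately show ?thesis
    by (simp add: class_sum_def sum.union_disjoint finite_residue_class)
qed

lemma sum_parity:
  fixes x :: "nat \<Rightarrow> real"
  shows "(\<Sum>j\<in>{1..2 ^ n}. (if odd j then a else b) * x j) =
    a * (class_sum n 2 x 1 + class_sum n 2 x 3) + b * (class_sum n 2 x 2 + class_sum n 2 x 4)"
proof -
  have "odd j \<longleftrightarrow> j mod 4 = 1 \<or> j mod 4 = 3" "even j \<longleftrightarrow> j mod 4 = 2 \<or> j mod 4 = 0"
    for j :: nat by presburger+
  then have eq: "{1..2 ^ n} \<inter> {j. odd j} = residue_class n 2 1 \<union> residue_class n 2 3"
    "{1..2 ^ n} \<inter> - {j. odd j} = residue_class n 2 2 \<union> residue_class n 2 4"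
    by (auto simp: residue_class_def)
  have disj: "residue_class n 2 1 \<inter> residue_class n 2 3 = {}"
    "residue_class n 2 2 \<inter> residue_class n 2 4 = {}"
    by (auto simp: residue_class_def)
  have "(\<Sum>j\<in>{1..2 ^ n}. (if odd j then a else b) * x j) =
      (\<Sum>j\<in>{1..2 ^ n}. if odd j then a * x j else b * x j)"
    by (rule sum.cong) auto
  also have "\<dots> = a * (\<Sum>j\<in>{1..2 ^ n} \<inter> {j. odd j}. x j) + b * (\<Sum>j\<in>{1..2 ^ n} \<inter> - {j. odd j}. x j)"
    by (simp add: sum.If_cases sum_distrib_left)
  finally show ?thesis
    unfolding eq by (simp add: class_sum_def sum.union_disjoint finite_residue_class disj del: One_nat_def)
qed

section \<open>Links and reflection symmetry of the edge sets\<close>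

lemma edge_sum_octets_upd:
  assumes "i \<in> {1..2 ^ n}" "r \<in> {1..8}" "r mod 8 = i mod 8"
  shows "edge_sum octets (class_sum n 3 (x(i := x i + 1))) - edge_sum octets (class_sum n 3 x) =
    link_sum octets r (class_sum n 3 x :: nat \<Rightarrow> real)"
proof -
  have "edge_sum octets (class_sum n 3 (x(i := x i + 1))) =
      edge_sum octets ((class_sum n 3 x)(r := class_sum n 3 x r + 1))"
  proof (rule edge_sum_cong)
    fix e k assume "e \<in> octets" "k \<in> e"
    then have k: "k \<in> {1..8}" by (rule triple_system_mem[OF triple_system_octets])
    then have "k mod 8 = i mod 8 \<longleftrightarrow> k = r"
      using assms(2) disjoint_residue_class[of 3] unfolding assms(3)[symmetric]
      by (cases "k = 8"; cases "r = 8") auto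
    then show "class_sum n 3 (x(i := x i + 1)) k = ((class_sum n 3 x)(r := class_sum n 3 x r + 1)) k"
      using class_sum_upd[OF assms(1), of 3 x "x i + 1" k] by auto
  qed
  then show ?thesis
    by (simp add: link_sum_eq_diff[OF triple_system_octets])
qed

text \<open>Changing an even coordinate affects the even copy of the preceding level and one class
  sum modulo 8, while the odd copy cancels from the difference.\<close>

lemma link_gamma_even:
  fixes u :: "nat \<Rightarrow> real"
  assumes "j \<in> {1..2 ^ (m + 3)}" "r \<in> {1..8}" "r mod 8 = (2 * j) mod 8"
  shows "link_sum (gamma_edges (Suc m)) (2 * j) u =
    link_sum (gamma_edges m) j (\<lambda>i. u (2 * i)) + link_sum octets r (class_sum (m + 4) 3 u)"
proof -
  have "2 * j \<in> {1..2 ^ (m + 4)}" using assms(1) by (auto simp: power_add)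
  note oct = edge_sum_octets_upd[OF this assms(2,3), of u]
  have upd: "(\<lambda>i. (u(2 * j := t)) (2 * i)) = (\<lambda>i. u (2 * i))(j := t)"
    "(\<lambda>i. (u(2 * j := t)) (2 * i - 1)) = (\<lambda>i. u (2 * i - 1))" for t
  proof -
    show "(\<lambda>i. (u(2 * j := t)) (2 * i)) = (\<lambda>i. u (2 * i))(j := t)" by auto
    have "2 * i - 1 \<noteq> 2 * j" for i using assms(1) by (auto, presburger)
    then show "(\<lambda>i. (u(2 * j := t)) (2 * i - 1)) = (\<lambda>i. u (2 * i - 1))" by simp
  qed
  show ?thesis
    unfolding link_sum_eq_diff[OF triple_system_gamma_edges] edge_sum_gamma_Suc upd oct[symmetric]
    by linarith
qed

lemma link_gamma_odd:
  fixes u :: "nat \<Rightarrow> real"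
  assumes "j \<in> {1..2 ^ (m + 3)}" "r \<in> {1..8}" "r mod 8 = (2 * j - 1) mod 8"
  shows "link_sum (gamma_edges (Suc m)) (2 * j - 1) u =
    link_sum (gamma_edges m) j (\<lambda>i. u (2 * i - 1)) + link_sum octets r (class_sum (m + 4) 3 u)"
proof -
  have "2 * j - 1 \<in> {1..2 ^ (m + 4)}" using assms(1) by (auto simp: power_add)
  note oct = edge_sum_octets_upd[OF this assms(2,3), of u]
  have upd: "(\<lambda>i. (u(2 * j - 1 := t)) (2 * i - 1)) = (\<lambda>i. u (2 * i - 1))(j := t)"
    "(\<lambda>i. (u(2 * j - 1 := t)) (2 * i)) = (\<lambda>i. u (2 * i))" for t
  proof -
    have "2 * i - 1 = 2 * j - 1 \<longleftrightarrow> i = j" for i using assms(1) by auto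
    then show "(\<lambda>i. (u(2 * j - 1 := t)) (2 * i - 1)) = (\<lambda>i. u (2 * i - 1))(j := t)" by auto
    have "2 * i \<noteq> 2 * j - 1" for i using assms(1) by (auto, presburger)
    then show "(\<lambda>i. (u(2 * j - 1 := t)) (2 * i)) = (\<lambda>i. u (2 * i))" by simp
  qed
  show ?thesis
    unfolding link_sum_eq_diff[OF triple_system_gamma_edges] edge_sum_gamma_Suc upd oct[symmetric]
    by linarith
qed

text \<open>The reflection interchanges the even and the odd copy, acting between them as the
  reflection one level lower, and sends residue \<open>k\<close> modulo 8 to \<open>9 - k\<close>, a
  symmetry of \<open>octets\<close>.\<close>

lemma edge_sum_gamma_mirror:
  "edge_sum (gamma_edges m) (\<lambda>i. x (2 ^ (m + 3) + 1 - i)) = edge_sum (gamma_edges m) x"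
proof (induction m arbitrary: x)
  case 0
  then show ?case
    unfolding edge_sum_gamma_0 edge_sum_octets by (simp add: algebra_simps)
next
  case (Suc m)
  let ?N = "2 ^ (m + 3) :: nat"
  let ?x = "\<lambda>i. x (2 ^ (Suc m + 3) + 1 - i)"
  have sub: "i \<in> {1..?N}" if "e \<in> gamma_edges m" "i \<in> e" for e i
    using triple_system_mem[OF triple_system_gamma_edges that] .
  have "edge_sum (gamma_edges m) (\<lambda>i. ?x (2 * i)) =
      edge_sum (gamma_edges m) (\<lambda>i. x (2 * (?N + 1 - i) - 1))"
  proof (rule edge_sum_cong)
    fix e i assume "e \<in> gamma_edges m" "i \<in> e"
    then have "2 ^ (Suc m + 3) + 1 - 2 * i = 2 * (?N + 1 - i) - 1" using sub[of e i] by (auto simp: power_add)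
    then show "?x (2 * i) = x (2 * (?N + 1 - i) - 1)" by simp
  qed
  moreover have "edge_sum (gamma_edges m) (\<lambda>i. ?x (2 * i - 1)) =
      edge_sum (gamma_edges m) (\<lambda>i. x (2 * (?N + 1 - i)))"
  proof (rule edge_sum_cong)
    fix e i assume "e \<in> gamma_edges m" "i \<in> e"
    then have "2 ^ (Suc m + 3) + 1 - (2 * i - 1) = 2 * (?N + 1 - i)" using sub[of e i] by (auto simp: power_add)
    then show "?x (2 * i - 1) = x (2 * (?N + 1 - i))" by simp
  qed
  moreover have "edge_sum octets (class_sum (m + 4) 3 ?x) = edge_sum octets (class_sum (m + 4) 3 x)"
  proof -
    have "class_sum (m + 4) 3 ?x k = class_sum (m + 4) 3 x (9 - k)" if "k \<in> {1..8}" for k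
      using class_sum_mirror[of 3 "m + 4" k x] that by (simp add: numeral_eq_Suc)
    then show ?thesis by (simp add: edge_sum_octets algebra_simps)
  qed
  ultimately show ?case
    using Suc[of "\<lambda>i. x (2 * i)"] Suc[of "\<lambda>i. x (2 * i - 1)"]
    by (simp only: edge_sum_gamma_Suc add.commute)
qed

text \<open>The reflection exchanges the parities, so equal parity sums make the reflected solution
  another maximiser.\<close>

lemma forced_gamma_mirror:
  fixes u :: "nat \<Rightarrow> real"
  assumes u: "\<And>j. j \<in> {1..2 ^ (m + 3)} \<Longrightarrow> u j > 0"
    and sol: "\<And>j. j \<in> {1..2 ^ (m + 3)} \<Longrightarrow>
      link_sum (gamma_edges m) j u + (if odd j then a else b) = l * (u j)\<^sup>2"
    and "a > 0" "b > 0"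
    and bal: "class_sum (m + 3) 2 u 1 + class_sum (m + 3) 2 u 3 =
      class_sum (m + 3) 2 u 2 + class_sum (m + 3) 2 u 4"
  shows "\<And>j. j \<in> {1..2 ^ (m + 3)} \<Longrightarrow> u (2 ^ (m + 3) + 1 - j) = u j" and "a = b"
proof -
  let ?N = "2 ^ (m + 3) :: nat"
  let ?k = "\<lambda>j::nat. if odd j then a else b"
  have parity: "odd (?N + 1 - j) \<longleftrightarrow> even j" if "j \<in> {1..?N}" for j
    using that by (simp add: even_diff_nat)
  have "(\<Sum>j\<in>{1..?N}. ?k j * u (?N + 1 - j)) =
      (\<Sum>j\<in>{1..?N}. (if odd (?N + 1 - j) then b else a) * u (?N + 1 - j))"
    by (rule sum.cong) (simp_all only: parity if_not_P, auto)
  also have "\<dots> = (\<Sum>j\<in>{1..?N}. (if odd j then b else a) * u j)"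
    by (rule sum_mirror[where f = "\<lambda>j. (if odd j then b else a) * u j"])
  \<comment> \<open>Reflection exchanges \<open>a\<close> and \<open>b\<close>, which leaves the
    forcing sum unchanged because the odd and even coordinate sums agree by
    \<open>bal\<close>.\<close>
  finally have forcing: "(\<Sum>j\<in>{1..?N}. ?k j * u (?N + 1 - j)) = (\<Sum>j\<in>{1..?N}. ?k j * u j)"
    unfolding sum_parity bal by (simp add: algebra_simps)
  show mirror: "u (?N + 1 - j) = u j" if "j \<in> {1..?N}" for j
  proof (rule forced_system_unique_maximiser[where u = u and k = ?k,
        OF triple_system_gamma_edges _ _ _ sol])
    show "edge_sum (gamma_edges m) (\<lambda>j. u (?N + 1 - j)) = edge_sum (gamma_edges m) u"
      by (rule edge_sum_gamma_mirror)
    show "(\<Sum>i\<in>{1..?N}. u (?N + 1 - i) ^ 3) = (\<Sum>i\<in>{1..?N}. u i ^ 3)"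
      by (rule sum_mirror)
    show "(\<Sum>j\<in>{1..?N}. ?k j * u (?N + 1 - j)) = (\<Sum>j\<in>{1..?N}. ?k j * u j)"
      by (rule forcing)
    show "u (?N + 1 - i) > 0" if "i \<in> {1..?N}" for i using that by (intro u) auto
  qed (use u that \<open>a > 0\<close> \<open>b > 0\<close> in auto)
  \<comment> \<open>Reflecting a perturbation at 1 gives the same perturbation at \<open>?N\<close>,
    so the links there agree. Since 1 is odd, \<open>?N\<close> is even and \<open>u\<close> agrees
    at both, the two equations force \<open>a = b\<close>.\<close>
  have "edge_sum (gamma_edges m) (u(1 := u 1 + 1)) =
      edge_sum (gamma_edges m) (\<lambda>j. (u(1 := u 1 + 1)) (?N + 1 - j))"
    by (rule edge_sum_gamma_mirror[symmetric])
  also have "\<dots> = edge_sum (gamma_edges m) (u(?N := u ?N + 1))"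
  proof (rule edge_sum_cong)
    fix e j assume "e \<in> gamma_edges m" "j \<in> e"
    then have "j \<in> {1..?N}"
      by (rule triple_system_mem[OF triple_system_gamma_edges])
    then show "(u(1 := u 1 + 1)) (?N + 1 - j) = (u(?N := u ?N + 1)) j"
      using mirror[of j] mirror[of ?N] by auto
  qed
  finally have "link_sum (gamma_edges m) 1 u = link_sum (gamma_edges m) ?N u"
    by (simp add: link_sum_eq_diff[OF triple_system_gamma_edges])
  then show "a = b"
    using sol[of 1] sol[of ?N] mirror[of ?N] by simp
qed

section \<open>Balanced solutions\<close>

text \<open>Substituting \<open>A (k + 4) = a - A k\<close> makes the links at opposite vertices
  \<open>r\<close> and \<open>r + 4\<close> coincide. Consequently, after halving the index, the
  forcing depends only on the parity of the new index.\<close>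

lemma link_octets_balanced:
  fixes A :: "nat \<Rightarrow> real"
  assumes "\<And>k. k \<in> {1..4} \<Longrightarrow> A k + A (k + 4) = a"
  shows "r \<in> {1, 5} \<Longrightarrow> link_sum octets r A = a\<^sup>2 + A 2 * A 8 + A 4 * A 6"
    and "r \<in> {3, 7} \<Longrightarrow> link_sum octets r A = a\<^sup>2 + A 2 * A 4 + A 6 * A 8"
    and "r \<in> {2, 6} \<Longrightarrow> link_sum octets r A = a\<^sup>2 + A 1 * A 3 + A 5 * A 7"
    and "r \<in> {4, 8} \<Longrightarrow> link_sum octets r A = a\<^sup>2 + A 1 * A 7 + A 3 * A 5"
proof -
  have A: "A 5 = a - A 1" "A 6 = a - A 2" "A 7 = a - A 3" "A 8 = a - A 4"
    using assms[of 1] assms[of 2] assms[of 3] assms[of 4] by (simp_all add: algebra_simps)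
  note simps = link_sum_eq_diff[OF triple_system_octets] edge_sum_octets A algebra_simps power2_eq_square
  show "r \<in> {1, 5} \<Longrightarrow> link_sum octets r A = a\<^sup>2 + A 2 * A 8 + A 4 * A 6"
    by (elim insertE emptyE) (simp_all add: simps)
  show "r \<in> {3, 7} \<Longrightarrow> link_sum octets r A = a\<^sup>2 + A 2 * A 4 + A 6 * A 8"
    by (elim insertE emptyE) (simp_all add: simps)
  show "r \<in> {2, 6} \<Longrightarrow> link_sum octets r A = a\<^sup>2 + A 1 * A 3 + A 5 * A 7"
    by (elim insertE emptyE) (simp_all add: simps)
  show "r \<in> {4, 8} \<Longrightarrow> link_sum octets r A = a\<^sup>2 + A 1 * A 7 + A 3 * A 5"
    by (elim insertE emptyE) (simp_all add: simps)
qed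

lemma class_sum_2_base:
  assumes "k \<in> {1..4}"
  shows "class_sum 3 2 u k = u k + (u (k + 4) :: real)"
proof -
  have "j \<in> residue_class 3 2 k \<longleftrightarrow> j = k \<or> j = k + 4" for j
  proof -
    have "j \<in> {1..8} \<Longrightarrow> j \<in> {1,2,3,4,5,6,7,8}" "k \<in> {1,2,3,4}" using assms by auto
    then show ?thesis unfolding residue_class_def by auto
  qed
  then have "residue_class 3 2 k = {k, k + 4}" by blast
  then show ?thesis by (simp add: class_sum_def)
qed

text \<open>The unknowns are the first four coordinates of a reflection-symmetric solution at level
  3, and \<open>bal\<close> is the equality of two class sums. The equations force all four to be
  equal, which is incompatible with the vertices having different degrees.\<close>

lemma base_equations_unsolvable:
  fixes A B C D c l :: real
  assumes pos: "A > 0" "B > 0" "C > 0" "D > 0" "c > 0"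
    and eqs: "B*C + 2*A*B + 2*C*D + B*D + C*C + c = l * A\<^sup>2"
      "2*C*D + 2*A*C + A*A + 2*B*D + A*D - A*C + c = l * B\<^sup>2"
      "D*(A + B) + D*D + B*D + A*B + 2*A*C + A*D + c = l * C\<^sup>2"
      "C*(A + B) + 2*C*D + B*C + A*B + B*B + A*C + c = l * D\<^sup>2"
    and bal: "A + D = B + C"
  shows False
proof -
  \<comment> \<open>\<open>P\<close> is the difference of the first two left-hand sides; it recurs
    with the opposite sign in the difference of the last two, so adding the differences eliminates
    it.\<close>
  define P where "P = (A - D) * (B - C)"
  have D: "D = B + C - A" using bal by simp
  have "(B*C + 2*A*B + 2*C*D + B*D + C*C + c) - (2*C*D + 2*A*C + A*A + 2*B*D + A*D - A*C + c) = P"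
    unfolding P_def D by (simp add: algebra_simps)
  then have P1: "l * (A\<^sup>2 - B\<^sup>2) = P" by (simp only: eqs right_diff_distrib)
  have "(D*(A + B) + D*D + B*D + A*B + 2*A*C + A*D + c) -
      (C*(A + B) + 2*C*D + B*C + A*B + B*B + A*C + c) = - (A\<^sup>2 - B\<^sup>2) - P"
    unfolding P_def D by (simp add: algebra_simps power2_eq_square)
  then have P2: "l * (C\<^sup>2 - D\<^sup>2) = - (A\<^sup>2 - B\<^sup>2) - P" by (simp only: eqs right_diff_distrib)
  have "l * A\<^sup>2 > 0" using eqs(1) pos by (smt (verit) mult_pos_pos)
  then have l: "l > 0" using pos by (simp add: zero_less_mult_iff)
  have "(A - B) * (l * (C + D) + l * (A + B) + (A + B)) = 0"
  proof -
    have "C - D = A - B" using D by simp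
    then have "l * (C\<^sup>2 - D\<^sup>2) = l * (A - B) * (C + D)"
      by (simp add: power2_eq_square square_diff_square_factored)
    moreover have "l * (A\<^sup>2 - B\<^sup>2) = l * (A - B) * (A + B)" "A\<^sup>2 - B\<^sup>2 = (A - B) * (A + B)"
      by (simp_all add: power2_eq_square square_diff_square_factored)
    ultimately have "(A - B) * (l * (C + D) + l * (A + B) + (A + B)) =
        l * (C\<^sup>2 - D\<^sup>2) + l * (A\<^sup>2 - B\<^sup>2) + (A\<^sup>2 - B\<^sup>2)"
      by (simp only: distrib_left mult.assoc mult.left_commute[of l "A - B"])
    then show ?thesis using P1 P2 by simp
  qed
  moreover have "l * (C + D) + l * (A + B) + (A + B) > 0" using l pos by (simp add: add_pos_pos)
  ultimately have AB: "A = B" by simp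
  then have "P = 0" using P1 by simp
  then have "C = A" "D = A" using AB D by (auto simp: P_def)
  \<comment> \<open>7 and 8 are the degrees of the vertices 1 and 3 in
    \<open>gamma_edges 0\<close>.\<close>
  then have "c + 7 * (A * A) = l * (A * A)" "c + 8 * (A * A) = l * (A * A)"
    using eqs(1,3) AB by (simp_all add: power2_eq_square algebra_simps)
  then have "A * A = 0" by linarith
  then show False using pos by simp
qed

text \<open>Shifting \<open>j\<close> by 1 before reducing yields representatives of
  \<open>2 * j\<close> and \<open>2 * j - 1\<close> modulo 8 within 1 to 8, as the octet links
  require.\<close>

lemma double_residue:
  fixes j :: nat
  assumes "j \<ge> 1"
  shows "(2 * ((j - 1) mod 4) + 2) mod 8 = (2 * j) mod 8"
    and "(2 * ((j - 1) mod 4) + 1) mod 8 = (2 * j - 1) mod 8"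
    and "odd j \<Longrightarrow> (j - 1) mod 4 \<in> {0, 2}"
    and "even j \<Longrightarrow> (j - 1) mod 4 \<in> {1, 3}"
proof -
  obtain i where i: "j = Suc i" using assms by (cases j) auto
  have *: "2 * (i mod 4) = (2 * i) mod 8" using mod_mult_mult1[of 2 i 4] by simp
  show "(2 * ((j - 1) mod 4) + 2) mod 8 = (2 * j) mod 8"
    and "(2 * ((j - 1) mod 4) + 1) mod 8 = (2 * j - 1) mod 8"
    by (simp_all add: i * mod_simps)
  have "even i \<Longrightarrow> i mod 4 = 0 \<or> i mod 4 = 2" "odd i \<Longrightarrow> i mod 4 = 1 \<or> i mod 4 = 3"
    by presburger+
  then show "odd j \<Longrightarrow> (j - 1) mod 4 \<in> {0, 2}" "even j \<Longrightarrow> (j - 1) mod 4 \<in> {1, 3}"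
    by (auto simp: i)
qed

lemma class_sum_mirror_invariant:
  assumes "\<And>j. j \<in> {1..2 ^ n} \<Longrightarrow> x (2 ^ n + 1 - j) = x j" "k \<in> {1..4}" "2 \<le> n"
  shows "class_sum n 2 x (5 - k) = class_sum n 2 x k"
proof -
  have "class_sum n 2 x (5 - k) = class_sum n 2 (\<lambda>j. x (2 ^ n + 1 - j)) k"
    using class_sum_mirror[of 2 n k x] assms(2,3) by (simp add: numeral_eq_Suc)
  also have "\<dots> = class_sum n 2 x k"
    unfolding class_sum_def by (rule sum.cong) (auto simp: residue_class_def assms(1)[simplified])
  finally show ?thesis .
qed

text \<open>Induction for all \<open>u\<close>, \<open>c\<close> and \<open>a\<close> with
  \<open>l\<close> fixed: the even half of a balanced solution is again balanced, with the octet
  contribution absorbed into \<open>c\<close>.\<close>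

lemma no_balanced_solution:
  fixes u :: "nat \<Rightarrow> real"
  assumes "\<And>j. j \<in> {1..2 ^ (m + 3)} \<Longrightarrow> u j > 0" and "c > 0"
    and "\<And>j. j \<in> {1..2 ^ (m + 3)} \<Longrightarrow> link_sum (gamma_edges m) j u + c = l * (u j)\<^sup>2"
    and "\<And>k. k \<in> {1..4} \<Longrightarrow> class_sum (m + 3) 2 u k = a"
  shows False
  using assms
proof (induction m arbitrary: u c a)
  case (0 u)
  note u = "0.prems"(1) and sol = "0.prems"(3)
  have cls: "u k + u (k + 4) = a" if "k \<in> {1..4}" for k
    using "0.prems"(4)[OF that] class_sum_2_base[OF that, of u] by simp
  have mirror: "u (9 - j) = u j" if "j \<in> {1..8}" for j
    using forced_gamma_mirror(1)[of 0 u c c l j] "0.prems" that by simp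
  have m: "u 5 = u 4" "u 6 = u 3" "u 7 = u 2" "u 8 = u 1"
    using mirror[of 1] mirror[of 2] mirror[of 3] mirror[of 4] by simp_all
  note simps = link_sum_eq_diff[OF triple_system_gamma_edges] edge_sum_gamma_0 edge_sum_octets m
    algebra_simps
  have "link_sum (gamma_edges 0) k u + c = l * (u k)\<^sup>2" if "k \<in> {1..4}" for k
    using sol[of k] that by simp
  from this[of 1] this[of 2] this[of 3] this[of 4]
  show False
    using u[of 1] u[of 2] u[of 3] u[of 4] \<open>c > 0\<close> cls[of 1] cls[of 2]
    by (intro base_equations_unsolvable[of "u 1" "u 2" "u 3" "u 4" c l]) (simp_all add: simps)
next
  case (Suc m)
  let ?N = "2 ^ (m + 3) :: nat"
  define A where "A = class_sum (m + 4) 3 u"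
  have lev: "Suc m + 3 = Suc (m + 3)" "m + 4 = Suc (m + 3)" by simp_all
  have lev4: "Suc m + 3 = m + 4" by simp
  have three: "3 = Suc (2 :: nat)" by simp
  note u = Suc.prems(1) and sol = Suc.prems(3)
  have bal: "A k + A (k + 4) = a" if "k \<in> {1..4}" for k
    using Suc.prems(4)[OF that, unfolded lev4] class_sum_2_eq_3[of "m + 4" u k] by (simp add: A_def)
  have even: "class_sum (m + 3) 2 (\<lambda>i. u (2 * i)) k = A (2 * k)" for k
    unfolding A_def lev three by (rule class_sum_double[symmetric])
  have odd: "class_sum (m + 3) 2 (\<lambda>i. u (2 * i - 1)) k = A (2 * k - 1)" if "k \<ge> 1" for k
    unfolding A_def lev three by (rule class_sum_double_minus[OF that, symmetric])
  have mem: "2 * j \<in> {1..2 ^ (Suc m + 3)}" "2 * j - 1 \<in> {1..2 ^ (Suc m + 3)}"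
    if "j \<in> {1..?N}" for j using that by (auto simp: power_add)
  have A_pos: "A k > 0" if "k \<in> {1..8}" for k
  proof -
    have "2 ^ 3 \<le> (2 :: nat) ^ (m + 4)" by (rule power_increasing) auto
    then have "k \<in> residue_class (m + 4) 3 k"
      using that by (auto simp: residue_class_def)
    then show ?thesis
      unfolding A_def class_sum_def using u
      by (intro sum_pos finite_residue_class) (auto simp: residue_class_def power_add)
  qed
  note link = link_octets_balanced[of A, OF bal]
  have sol_even: "link_sum (gamma_edges m) j (\<lambda>i. u (2 * i)) +
      (if odd j then c + (a\<^sup>2 + A 1 * A 3 + A 5 * A 7) else c + (a\<^sup>2 + A 1 * A 7 + A 3 * A 5)) =
      l * (u (2 * j))\<^sup>2" if j: "j \<in> {1..?N}" for j
  proof -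
    define r where "r = 2 * ((j - 1) mod 4) + 2"
    have r: "r \<in> (if odd j then {2, 6} else {4, 8})" "r mod 8 = (2 * j) mod 8"
      using double_residue[of j] j by (auto simp: r_def)
    then have "r \<in> {1..8}" by (auto split: if_splits)
    then show ?thesis
      using link_gamma_even[OF j _ r(2), of u] sol[OF mem(1)[OF j]] r(1) link(3,4)[of r]
      by (auto simp: A_def split: if_splits)
  qed
  have sol_odd: "link_sum (gamma_edges m) j (\<lambda>i. u (2 * i - 1)) +
      (if odd j then c + (a\<^sup>2 + A 2 * A 8 + A 4 * A 6) else c + (a\<^sup>2 + A 2 * A 4 + A 6 * A 8)) =
      l * (u (2 * j - 1))\<^sup>2" if j: "j \<in> {1..?N}" for j
  proof -
    define r where "r = 2 * ((j - 1) mod 4) + 1"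
    have r: "r \<in> (if odd j then {1, 5} else {3, 7})" "r mod 8 = (2 * j - 1) mod 8"
      using double_residue[of j] j by (auto simp: r_def)
    then have "r \<in> {1..8}" by (auto split: if_splits)
    then show ?thesis
      using link_gamma_odd[OF j _ r(2), of u] sol[OF mem(2)[OF j]] r(1) link(1,2)[of r]
      by (auto simp: A_def split: if_splits)
  qed
  have pos: "c + (a\<^sup>2 + A i * A j + A k * A n) > 0"
    if "i \<in> {1..8}" "j \<in> {1..8}" "k \<in> {1..8}" "n \<in> {1..8}" for i j k n
    using Suc.prems(2) A_pos that by (intro add_pos_pos add_nonneg_pos mult_pos_pos) auto
  have u0: "u (2 * j) > 0" "u (2 * j - 1) > 0" if "j \<in> {1..?N}" for j
    using u mem that by blast+
  have bal_even: "class_sum (m + 3) 2 (\<lambda>i. u (2 * i)) 1 + class_sum (m + 3) 2 (\<lambda>i. u (2 * i)) 3 =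
      class_sum (m + 3) 2 (\<lambda>i. u (2 * i)) 2 + class_sum (m + 3) 2 (\<lambda>i. u (2 * i)) 4"
    using bal[of 2] bal[of 4] unfolding even by simp
  \<comment> \<open>This yields both the reflection symmetry of the even half and the equality of
    its two forcing constants; the odd half is treated in the same way below.\<close>
  note mirror_even = forced_gamma_mirror[where u = "\<lambda>i. u (2 * i)",
      OF u0(1) sol_even pos pos bal_even, simplified]
  have bal_odd: "class_sum (m + 3) 2 (\<lambda>i. u (2 * i - 1)) 1 + class_sum (m + 3) 2 (\<lambda>i. u (2 * i - 1)) 3 =
      class_sum (m + 3) 2 (\<lambda>i. u (2 * i - 1)) 2 + class_sum (m + 3) 2 (\<lambda>i. u (2 * i - 1)) 4"
    using bal[of 1] bal[of 3] odd[of 1] odd[of 2] odd[of 3] odd[of 4] by simp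
  note mirror_odd = forced_gamma_mirror[where u = "\<lambda>i. u (2 * i - 1)",
      OF u0(2) sol_odd pos pos bal_odd, simplified]
  have sym_even: "A (2 * (5 - k)) = A (2 * k)" if "k \<in> {1..4}" for k
    using class_sum_mirror_invariant[of "m + 3" "\<lambda>i. u (2 * i)" k] mirror_even(1) that
    unfolding even by simp
  have sym_odd: "A (2 * (5 - k) - 1) = A (2 * k - 1)" if "k \<in> {1..4}" for k
  proof -
    have k: "k \<ge> 1" "5 - k \<ge> 1" using that by auto
    show ?thesis
      unfolding odd[OF k(1), symmetric] odd[OF k(2), symmetric]
      by (rule class_sum_mirror_invariant) (use mirror_odd(1) that in auto)
  qed
  have A: "A 8 = A 2" "A 6 = A 4" "A 7 = A 1" "A 5 = A 3"
    using sym_even[of 1] sym_even[of 2] sym_odd[of 1] sym_odd[of 2] by simp_all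
  \<comment> \<open>The forcing of each half involves the classes of the other: equal constants on
    the odd half read \<open>A 2 ^ 2 + A 4 ^ 2 = 2 * A 2 * A 4\<close>, those on the even half
    \<open>2 * A 1 * A 3 = A 1 ^ 2 + A 3 ^ 2\<close>.\<close>
  have "(A 2 - A 4)\<^sup>2 = 0" "(A 1 - A 3)\<^sup>2 = 0"
    using mirror_even(2) mirror_odd(2) by (simp_all add: A power2_eq_square algebra_simps)
  then have eq: "A 4 = A 2" "A 3 = A 1" by simp_all
  show False
  proof (rule Suc.IH[of "\<lambda>i. u (2 * i)" "c + (a\<^sup>2 + A 1 * A 3 + A 5 * A 7)" "A 2"])
    show "class_sum (m + 3) 2 (\<lambda>i. u (2 * i)) k = A 2" if "k \<in> {1..4}" for k
    proof -
      have "k \<in> {1, 2, 3, 4}" using that by auto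
      then show ?thesis unfolding even by (auto simp: A eq)
    qed
    show "link_sum (gamma_edges m) j (\<lambda>i. u (2 * i)) + (c + (a\<^sup>2 + A 1 * A 3 + A 5 * A 7)) =
        l * (u (2 * j))\<^sup>2" if "j \<in> {1..?N}" for j
      using sol_even[OF that] by (simp add: A eq split: if_splits)
  qed (use u0 pos in auto)
qed

section \<open>Comparison of the two hypergraphs\<close>

text \<open>The apex \<open>0\<close> is blown up to itself, so the patterns below describe \<open>M\<^sub>0\<close> and \<open>M\<^sub>1\<close>.\<close>

definition cone_class :: "nat \<Rightarrow> nat \<Rightarrow> nat set" where
  "cone_class n k = (if k = 0 then {0} else residue_class n 2 k)"

definition join_edges :: "nat \<Rightarrow> nat set set \<Rightarrow> nat set set" where
  "join_edges m F = gamma_edges m \<union> blow_up (cone_class (m + 3)) F"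

text \<open>Every pattern edge contains the apex, which keeps its blow-up disjoint from
  \<open>gamma_edges\<close>; covering all pattern vertices joins every vertex to the apex by an
  edge.\<close>

definition cone_pattern :: "nat set set \<Rightarrow> bool" where
  "cone_pattern F \<longleftrightarrow>
     triple_system {0..4} F \<and> (\<forall>t\<in>F. 0 \<in> t) \<and> (\<forall>k\<in>{0..4}. \<exists>t\<in>F. k \<in> t)"

definition X_pattern :: "nat set set" where
  "X_pattern = set_of_triple ` {(0,1,2), (0,3,4)}"

definition Y_pattern :: "nat set set" where
  "Y_pattern = set_of_triple ` {(0,1,4), (0,2,3)}"

lemma cone_pattern_X: "cone_pattern X_pattern" and cone_pattern_Y: "cone_pattern Y_pattern"
proof -
  have "k \<in> {0,1,2,3,4}" if "k \<in> {0..4}" for k :: nat using that by auto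
  then show "cone_pattern X_pattern" "cone_pattern Y_pattern"
    unfolding cone_pattern_def triple_system_def X_pattern_def Y_pattern_def set_of_triple_def
    by auto
qed

lemma edge_sum_X_pattern: "edge_sum X_pattern A = A 0 * (A 1 * A 2 + A 3 * A 4)"
  unfolding X_pattern_def by (subst edge_sum_triples) (auto simp: algebra_simps)

lemma edge_sum_Y_pattern: "edge_sum Y_pattern A = A 0 * (A 1 * A 4 + A 2 * A 3)"
  unfolding Y_pattern_def by (subst edge_sum_triples) (auto simp: algebra_simps)

lemma disjoint_cone_class: "disjoint_family_on (cone_class n) {0..4}"
proof -
  have "i = j" if "i \<in> {1..4}" "j \<in> {1..4}" "i mod 4 = j mod 4" for i j :: nat
    using that by (cases "i = 4"; cases "j = 4") auto
  then show ?thesis by (auto simp: disjoint_family_on_def cone_class_def residue_class_def)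
qed

lemma finite_cone_class: "finite (cone_class n k)"
  by (simp add: cone_class_def finite_residue_class)

lemma triple_system_join_edges:
  assumes "cone_pattern F"
  shows "triple_system {0..2 ^ (m + 3)} (join_edges m F)"
proof -
  have "triple_system {0..2 ^ (m + 3)} (blow_up (cone_class (m + 3)) F)"
    using assms by (intro triple_system_blow_up[OF _ disjoint_cone_class])
      (auto simp: cone_pattern_def cone_class_def residue_class_def)
  moreover have "triple_system {0..2 ^ (m + 3)} (gamma_edges m)"
    using triple_system_gamma_edges[of m] by (fastforce simp: triple_system_def)
  ultimately show ?thesis by (auto simp: triple_system_def join_edges_def)
qed

lemma edge_sum_join_edges:
  assumes "cone_pattern F"
  shows "edge_sum (join_edges m F) x = edge_sum (gamma_edges m) x +
    edge_sum F (\<lambda>k. if k = 0 then x 0 else class_sum (m + 3) 2 x k)"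
proof -
  have F: "triple_system {0..4} F" using assms by (simp add: cone_pattern_def)
  have "0 \<in> e" if mem: "e \<in> blow_up (cone_class (m + 3)) F" for e
  proof -
    obtain t g where e: "t \<in> F" "g \<in> PiE t (cone_class (m + 3))" "e = g ` t"
      using mem by (auto simp: blow_up_def)
    then have "0 \<in> t" using assms by (simp add: cone_pattern_def)
    then have "g 0 = 0" using e(2) by (auto simp: PiE_def Pi_def cone_class_def)
    then show ?thesis using e(3) \<open>0 \<in> t\<close> by force
  qed
  moreover have "0 \<notin> e" if "e \<in> gamma_edges m" for e
    using triple_system_mem[OF triple_system_gamma_edges that, of 0] by auto
  ultimately have "gamma_edges m \<inter> blow_up (cone_class (m + 3)) F = {}" by blast
  moreover have "finite (join_edges m F)"
    using triple_system_finite(2)[OF triple_system_join_edges[OF assms]] .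
  ultimately have "edge_sum (join_edges m F) x =
      edge_sum (gamma_edges m) x + edge_sum (blow_up (cone_class (m + 3)) F) x"
    unfolding join_edges_def by (intro edge_sum_Un) auto
  also have "edge_sum (blow_up (cone_class (m + 3)) F) x =
      edge_sum F (\<lambda>k. \<Sum>j\<in>cone_class (m + 3) k. x j)"
    by (intro edge_sum_blow_up[OF F disjoint_cone_class] finite_cone_class)
  also have "(\<lambda>k. \<Sum>j\<in>cone_class (m + 3) k. x j) =
      (\<lambda>k. if k = 0 then x 0 else class_sum (m + 3) 2 x k)"
    by (auto simp: cone_class_def class_sum_def)
  finally show ?thesis .
qed

text \<open>Supplies the connectivity used for existence and symmetry of Perron vectors: a pattern
  edge through the class of \<open>i\<close> contains the apex and has a transversal through
  \<open>i\<close>.\<close>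

lemma join_edges_star:
  assumes F: "cone_pattern F" and i: "i \<in> {0..2 ^ (m + 3)}"
  shows "\<exists>e\<in>join_edges m F. 0 \<in> e \<and> i \<in> e"
proof -
  have self: "k \<in> cone_class (m + 3) k" if "k \<in> {0..4}" for k
  proof -
    have "2 ^ 2 \<le> (2 :: nat) ^ (m + 3)" by (rule power_increasing) auto
    then show ?thesis using that by (auto simp: cone_class_def residue_class_def)
  qed
  have "\<exists>k\<in>{0..4}. i \<in> cone_class (m + 3) k"
  proof (cases "i = 0")
    case False
    then have "i \<in> cone_class (m + 3) ((i - 1) mod 4 + 1)"
      using i by (auto simp: cone_class_def residue_class_def mod_simps)
    moreover have "(i - 1) mod 4 < 4" by simp
    then have "(i - 1) mod 4 + 1 \<in> {0..4}" unfolding atLeastAtMost_iff by linarith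
    ultimately show ?thesis by blast
  qed (auto simp: cone_class_def)
  then obtain k where k: "k \<in> {0..4}" "i \<in> cone_class (m + 3) k" by blast
  obtain t where t: "t \<in> F" "k \<in> t"
    using F k(1) unfolding cone_pattern_def by blast
  have t': "0 \<in> t" "t \<subseteq> {0..4}"
    using F t(1) by (simp_all add: cone_pattern_def triple_system_def)
  \<comment> \<open>The transversal takes \<open>i\<close> in class \<open>k\<close> and, in every
    other class, its index as representative; this index is a vertex because
    \<open>4 \<le> 2 ^ (m + 3)\<close>.\<close>
  define g where "g = (\<lambda>j\<in>t. if j = k then i else j)"
  have "g \<in> PiE t (cone_class (m + 3))"
    using self t'(2) k(2) by (auto simp: g_def)
  then have "g ` t \<in> join_edges m F" using t(1) by (auto simp: join_edges_def blow_up_def)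
  moreover have "i \<in> g ` t" using t(2) by (intro image_eqI[of _ _ k]) (auto simp: g_def)
  moreover have "0 \<in> g ` t"
    using t'(1) k(2) by (intro image_eqI[of _ _ 0]) (auto simp: g_def cone_class_def split: if_splits)
  ultimately show ?thesis by (intro bexI[of _ "g ` t"] conjI)
qed

lemma hypergraph_of_join_edges:
  assumes "cone_pattern F"
  shows "hypergraph_of {0..2 ^ (m + 3)} (edge_sum (join_edges m F) Var) =
    ({0..2 ^ (m + 3)}, join_edges m F)"
  using hypergraph_of_lagrangian[OF triple_system_finite(1,4)[OF triple_system_join_edges[OF assms]]]
  by (simp only: lagrangian_eq_edge_sum)

lemma X_hyp_eq: "X_hyp (m + 3) = ({0..2 ^ (m + 3)}, join_edges m X_pattern)"
proof -
  have "Gam (m + 3) + M0 (m + 3) = edge_sum (join_edges m X_pattern) Var"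
    unfolding edge_sum_join_edges[OF cone_pattern_X] edge_sum_X_pattern Gam_eq M0_def Ehom_def
    by (simp add: subst_add subst_mult subst_Var class_sum_def residue_class_def)
  then show ?thesis
    using hypergraph_of_join_edges[OF cone_pattern_X] by (simp add: X_hyp_def)
qed

lemma Y_hyp_eq: "Y_hyp (m + 3) = ({0..2 ^ (m + 3)}, join_edges m Y_pattern)"
proof -
  have "Gam (m + 3) + M1 (m + 3) = edge_sum (join_edges m Y_pattern) Var"
    unfolding edge_sum_join_edges[OF cone_pattern_Y] edge_sum_Y_pattern Gam_eq M1_def Ehom_def
    by (simp add: subst_add subst_mult subst_Var class_sum_def residue_class_def)
  then show ?thesis
    using hypergraph_of_join_edges[OF cone_pattern_Y] by (simp add: Y_hyp_def)
qed

text \<open>Raising coordinate \<open>i\<close> raises one class sum, whose coefficient is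
  \<open>v 0\<close> times the sum of the partner class. Balance makes this the same constant for
  every \<open>i\<close>.\<close>

lemma link_sum_join_X:
  fixes v :: "nat \<Rightarrow> real"
  assumes i: "i \<in> {1..2 ^ (m + 3)}" and bal: "\<And>k. k \<in> {1..4} \<Longrightarrow> class_sum (m + 3) 2 v k = a"
  shows "link_sum (join_edges m X_pattern) i v = link_sum (gamma_edges m) i v + v 0 * a"
proof -
  have "i mod 4 \<in> {0, 1, 2, 3}" by auto
  then have upd: "edge_sum X_pattern
        (\<lambda>k. if k = 0 then v 0 else class_sum (m + 3) 2 (v(i := v i + 1)) k) =
      edge_sum X_pattern (\<lambda>k. if k = 0 then v 0 else class_sum (m + 3) 2 v k) + v 0 * a"
    unfolding edge_sum_X_pattern using bal[of 1] bal[of 2] bal[of 3] bal[of 4]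
    by (elim insertE emptyE) (simp_all add: class_sum_upd[OF i] algebra_simps)
  have v0: "(v(i := v i + 1)) 0 = v 0" using i by auto
  show ?thesis
    unfolding link_sum_eq_diff[OF triple_system_join_edges[OF cone_pattern_X]]
      link_sum_eq_diff[OF triple_system_gamma_edges] edge_sum_join_edges[OF cone_pattern_X]
      v0 upd by simp
qed

text \<open>Reflection sends class \<open>k\<close> to \<open>5 - k\<close> and so exchanges the
  pairs 1, 2 and 3, 4 of \<open>X_pattern\<close>. The reflected vector is thus another maximiser
  with the same apex value.\<close>

lemma perron_pair_X_mirror:
  assumes v: "perron_pair {0..2 ^ (m + 3)} (join_edges m X_pattern) l v"
    and "i \<in> {1..2 ^ (m + 3)}"
  shows "v (2 ^ (m + 3) + 1 - i) = v i"
proof -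
  let ?N = "2 ^ (m + 3) :: nat"
  let ?V = "{0..?N}"
  \<comment> \<open>The apex is treated separately, since the formula would send index 0 out of the
    vertex set.\<close>
  define w where "w = (\<lambda>i. if i = 0 then v 0 else v (?N + 1 - i))"
  have V: "?V = insert 0 {1..?N}" by auto
  have cls: "class_sum (m + 3) 2 w k = class_sum (m + 3) 2 v (5 - k)" if "k \<in> {1..4}" for k
  proof -
    have "class_sum (m + 3) 2 w k = class_sum (m + 3) 2 (\<lambda>i. v (?N + 1 - i)) k"
      unfolding class_sum_def by (rule sum.cong) (auto simp: w_def residue_class_def)
    then show ?thesis using class_sum_mirror[of 2 "m + 3" k v] that by (simp add: numeral_eq_Suc)
  qed
  have "edge_sum (gamma_edges m) w = edge_sum (gamma_edges m) (\<lambda>i. v (?N + 1 - i))"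
  proof (rule edge_sum_cong)
    fix e j assume "e \<in> gamma_edges m" "j \<in> e"
    then have "j \<in> {1..?N}" by (rule triple_system_mem[OF triple_system_gamma_edges])
    then show "w j = v (?N + 1 - j)" by (simp add: w_def)
  qed
  then have edge: "edge_sum (join_edges m X_pattern) w = edge_sum (join_edges m X_pattern) v"
    using cls[of 1] cls[of 2] cls[of 3] cls[of 4]
    unfolding edge_sum_join_edges[OF cone_pattern_X] edge_sum_X_pattern edge_sum_gamma_mirror
    by (simp add: w_def algebra_simps)
  have "(\<Sum>i\<in>{1..?N}. w i ^ 3) = (\<Sum>i\<in>{1..?N}. v (?N + 1 - i) ^ 3)"
    by (rule sum.cong) (auto simp: w_def)
  also have "\<dots> = (\<Sum>i\<in>{1..?N}. v i ^ 3)" by (rule sum_mirror)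
  finally have "(\<Sum>i\<in>?V. w i ^ 3) = (\<Sum>i\<in>?V. v i ^ 3)" unfolding V by (simp add: w_def)
  then have cubes: "(\<Sum>i\<in>?V. w i ^ 3) = 1" using v by (simp add: perron_pair_def)
  have "w i = v i"
  proof (rule perron_pair_symmetric[OF triple_system_join_edges[OF cone_pattern_X] v
        join_edges_star[OF cone_pattern_X] _ _ cubes edge])
    show "w j > 0" if "j \<in> ?V" for j using v that by (auto simp: perron_pair_def w_def)
  qed (use assms(2) in \<open>auto simp: w_def\<close>)
  then show ?thesis using assms(2) by (simp add: w_def)
qed

lemma perron_eigenvalues_differ:
  assumes v: "perron_pair {0..2 ^ (m + 3)} (join_edges m X_pattern) l v"
    and w: "perron_pair {0..2 ^ (m + 3)} (join_edges m Y_pattern) l w"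
  shows False
proof -
  let ?N = "2 ^ (m + 3) :: nat"
  let ?a = "class_sum (m + 3) 2 v"
  have pos: "v i > 0" if "i \<in> {0..?N}" for i using v that by (simp add: perron_pair_def)
  have sym: "?a (5 - k) = ?a k" if "k \<in> {1..4}" for k
    by (rule class_sum_mirror_invariant) (use perron_pair_X_mirror[OF v] that in auto)
  have a: "?a 4 = ?a 1" "?a 3 = ?a 2" using sym[of 1] sym[of 2] by simp_all
  \<comment> \<open>With \<open>?a 4 = ?a 1\<close> and \<open>?a 3 = ?a 2\<close> the cone of
    \<open>Y\<close> contributes the sum of two squares and that of \<open>X\<close> twice the mixed
    product.\<close>
  have "edge_sum (join_edges m Y_pattern) v = edge_sum (join_edges m X_pattern) v + v 0 * (?a 1 - ?a 2)\<^sup>2"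
    unfolding edge_sum_join_edges[OF cone_pattern_X] edge_sum_join_edges[OF cone_pattern_Y]
      edge_sum_X_pattern edge_sum_Y_pattern
    by (simp add: a power2_eq_square algebra_simps)
  \<comment> \<open>The eigenvector \<open>v\<close> of \<open>X\<close> serves as a competitor in
    the maximum problem for \<open>Y\<close>, whose value is assumed to be the same
    \<open>l\<close>.\<close>
  moreover have "3 * edge_sum (join_edges m Y_pattern) v \<le> l"
    using perron_pair_max[OF triple_system_join_edges[OF cone_pattern_Y] w, of v] v
    by (simp add: perron_pair_def)
  moreover have "3 * edge_sum (join_edges m X_pattern) v = l"
    by (rule perron_pair_edge_sum[OF triple_system_join_edges[OF cone_pattern_X] v])
  ultimately have "v 0 * (?a 1 - ?a 2)\<^sup>2 \<le> 0" by simp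
  then have "?a 1 = ?a 2" using pos[of 0] by (simp add: mult_le_0_iff)
  then have bal: "?a k = ?a 1" if "k \<in> {1..4}" for k
  proof -
    have "k \<in> {1, 2, 3, 4}" using that by auto
    then show ?thesis using a \<open>?a 1 = ?a 2\<close> by auto
  qed
  have "1 \<in> residue_class (m + 3) 2 1" by (simp add: residue_class_def)
  then have "residue_class (m + 3) 2 1 \<noteq> {}" by blast
  moreover have "v i > 0" if "i \<in> residue_class (m + 3) 2 1" for i
    using that by (intro pos) (simp add: residue_class_def)
  ultimately have "?a 1 > 0"
    unfolding class_sum_def by (intro sum_pos finite_residue_class)
  then have c: "v 0 * ?a 1 > 0" using pos[of 0] by simp
  show False
  proof (rule no_balanced_solution[OF _ c _ bal])
    show "v j > 0" if "j \<in> {1..?N}" for j using pos that by simp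
    show "link_sum (gamma_edges m) j v + v 0 * ?a 1 = l * (v j)\<^sup>2" if "j \<in> {1..?N}" for j
      using link_sum_join_X[OF that bal] v that by (simp add: perron_pair_def)
  qed
qed

theorem theorem3p13:
  fixes n :: nat
  assumes "n \<ge> 3"
  shows "principal_eigenvalue 3 (X_hyp n) \<noteq> principal_eigenvalue 3 (Y_hyp n)"
proof -
  obtain m where n: "n = m + 3" using assms by (metis le_add_diff_inverse2)
  let ?V = "{0..2 ^ (m + 3)} :: nat set"
  note X = triple_system_join_edges[OF cone_pattern_X, of m]
  note Y = triple_system_join_edges[OF cone_pattern_Y, of m]
  obtain l v where v: "perron_pair ?V (join_edges m X_pattern) l v"
    using perron_pair_exists[OF X _ join_edges_star[OF cone_pattern_X]] by auto
  obtain k w where w: "perron_pair ?V (join_edges m Y_pattern) k w"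
    using perron_pair_exists[OF Y _ join_edges_star[OF cone_pattern_Y]] by auto
  have "l \<noteq> k" using perron_eigenvalues_differ v w by blast
  then show ?thesis
    using principal_eigenvalue_eq[OF X v] principal_eigenvalue_eq[OF Y w]
    by (simp add: n X_hyp_eq Y_hyp_eq)
qed

end
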